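(* Define sequences $\gamma(n)$ and $\delta(n)$ by the formal power series expansions $$\sum_{n\ge0}\gamma(n)q^n=\frac{(-q,-q^4;q^5)_\infty^2(q^4,q^6;q^{10})_\infty}{(-q^2,-q^3;q^5)_\infty^2(q^3,q^7;q^{10})_\infty},\qquad \sum_{n\ge0}\delta(n)q^n=\frac{(-q^2,-q^3;q^5)_\infty^2(q^2,q^8;q^{10})_\infty}{(-q,-q^4;q^5)_\infty^2(q,q^9;q^{10})_\infty}.$$ Then for every integer $n\ge0$, $\gamma(5n+4)=0$ and $\delta(5n+4)=0$.
   Context: $(A;q)_\infty=\prod_{k\ge0}(1-Aq^k)$ and $(A_1,\dots,A_n;q)_\infty=(A_1;q)_\infty\cdots(A_n;q)_\infty$. *)

theory Defs
  imports "HOL-Analysis.Analysis" "HOL-Computational_Algebra.Formal_Power_Series"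
begin

text \<open>
  The infinite product is the library's \<open>prodinf\<close>. On formal power series its limit is taken in
  the library's topology on \<open>fps\<close> (the \<open>X\<close>-adic one). Over a field it converges whenever
  \<open>q\<close> has zero constant coefficient; if \<open>A\<close> has zero constant coefficient as well, its value has
  constant coefficient 1 and so is invertible.
\<close>

definition qpoch_inf :: "'a :: {t2_space, comm_ring_1} \<Rightarrow> 'a \<Rightarrow> 'a" where
  "qpoch_inf A q = (\<Prod>k. 1 - A * q ^ k)"

definition qpochs_inf :: "'a :: {t2_space, comm_ring_1} list \<Rightarrow> 'a \<Rightarrow> 'a" where
  "qpochs_inf As q = (\<Prod>A\<leftarrow>As. qpoch_inf A q)"

end

theory Submission imports Defs begin

text \<open>
  Write \<open>P = q\<^sup>5\<close> and \<open>\<theta>(z) = (z, P / z; P)\<^sub>\<infinity>\<close>. Splitting the products by residues shows that the two series are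
  \<open>\<theta>(- x)\<^sup>3 \<theta>(x) / \<theta>(- x\<^sup>2)\<close> for \<open>x = q\<close> and for \<open>x = q\<^sup>2\<close>. By the Jacobi triple product and a parity dissection,
  \<open>\<theta>(- x)\<^sup>2\<close> is a combination of \<open>(- x\<^sup>2, - P\<^sup>2 / x\<^sup>2; P\<^sup>2)\<^sub>\<infinity>\<close> and \<open>x (- P x\<^sup>2, - P / x\<^sup>2; P\<^sup>2)\<^sub>\<infinity>\<close> with coefficients
  depending on \<open>P\<close> only, and the product of these two theta functions is the denominator \<open>\<theta>(- x\<^sup>2)\<close>. Hence, up to
  factors in \<open>P\<close>, the series is a sum of two quotients of a theta function by a theta function, each of which is a
  Lambert series
  \<open>\<Sum>l. (- 1)\<^sup>l z\<^sup>l / (1 + P\<^sup>k)\<close> with \<open>k = 2 l + \<kappa>\<close> and \<open>\<kappa> = 0\<close> or \<open>\<kappa> = 1\<close>. The coefficients of the latter are signed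
  counts of factorizations, and in the residue class in question swapping the two factors reverses the sign.
  Multiplying or dividing by a series in \<open>P\<close> preserves the vanishing in a residue class modulo 5.
\<close>

section \<open>Infinite sums of formal power series\<close>

text \<open>This instance and the next make the \<open>has_sum\<close> and limit rules available for
  power series, where convergence means that every coefficient is eventually constant.\<close>

instance fps :: (ab_group_add) topological_comm_monoid_add
proof
  fix a b :: "'a fps"
  show "((\<lambda>x. fst x + snd x) \<longlongrightarrow> a + b) (nhds a \<times>\<^sub>F nhds b)"
    unfolding tendsto_fps_iff
  proof
    fix n
    have "eventually (\<lambda>x. fps_nth x n = fps_nth a n) (nhds a)"
      "eventually (\<lambda>x. fps_nth x n = fps_nth b n) (nhds b)"
      using filterlim_ident[of "nhds a"] filterlim_ident[of "nhds b"] unfolding tendsto_fps_iff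
      by blast+
    from eventually_prodI[OF this]
    show "\<forall>\<^sub>F x in nhds a \<times>\<^sub>F nhds b. fps_nth (fst x + snd x) n = fps_nth (a + b) n"
      by eventually_elim simp
  qed
qed

text \<open>Coefficient \<open>n\<close> of a product depends only on the coefficients up to
  \<open>n\<close> of the factors.\<close>

instance fps :: (comm_ring_1) topological_semigroup_mult
proof
  fix a b :: "'a fps"
  show "((\<lambda>x. fst x * snd x) \<longlongrightarrow> a * b) (nhds a \<times>\<^sub>F nhds b)"
    unfolding tendsto_fps_iff
  proof
    fix n
    have "eventually (\<lambda>x. \<forall>k\<le>n. fps_nth x k = fps_nth a k) (nhds a)"
      "eventually (\<lambda>x. \<forall>k\<le>n. fps_nth x k = fps_nth b k) (nhds b)"
      by (rule eventually_fps_nth_eq_nhds_fps_strong)+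
    from eventually_prodI[OF this]
    show "\<forall>\<^sub>F x in nhds a \<times>\<^sub>F nhds b. fps_nth (fst x * snd x) n = fps_nth (a * b) n"
      by eventually_elim (auto simp: fps_mult_nth intro!: sum.cong)
  qed
qed

text \<open>Coefficients of a convergent net are eventually constant, which reduces summation over
  any index set to finite sums, one degree at a time.\<close>

lemma has_sum_fps_iff:
  fixes f :: "'i \<Rightarrow> 'a :: ab_group_add fps"
  shows "(f has_sum S) I \<longleftrightarrow>
    (\<forall>n. \<exists>F. finite F \<and> F \<subseteq> I \<and> (\<forall>i\<in>I-F. fps_nth (f i) n = 0) \<and> fps_nth S n = (\<Sum>i\<in>F. fps_nth (f i) n))"
    (is "_ \<longleftrightarrow> (\<forall>n. \<exists>F. ?P n F)")
proof
  assume "(f has_sum S) I"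
  then have ev: "\<forall>\<^sub>F F in finite_subsets_at_top I. fps_nth (sum f F) n = fps_nth S n" for n
    by (simp add: has_sum_def tendsto_fps_iff)
  show "\<forall>n. \<exists>F. ?P n F"
  proof
    fix n
    obtain F where F: "finite F" "F \<subseteq> I"
      and eq: "\<And>G. finite G \<Longrightarrow> F \<subseteq> G \<Longrightarrow> G \<subseteq> I \<Longrightarrow> fps_nth (sum f G) n = fps_nth S n"
      using ev[of n] unfolding eventually_finite_subsets_at_top by metis
    \<comment> \<open>Enlarging \<open>F\<close> by \<open>i\<close> leaves the coefficient
      unchanged, so \<open>i\<close> contributes nothing.\<close>
    have "fps_nth (f i) n = 0" if "i \<in> I - F" for i
    proof -
      have "fps_nth (sum f (insert i F)) n = fps_nth (sum f F) n"
        using eq[of "insert i F"] eq[of F] F that by auto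
      then show ?thesis using F that by simp
    qed
    with F eq[of F] show "\<exists>F. ?P n F" by (intro exI[of _ F]) (auto simp: fps_sum_nth)
  qed
next
  assume *: "\<forall>n. \<exists>F. ?P n F"
  show "(f has_sum S) I"
    unfolding has_sum_def tendsto_fps_iff
  proof
    fix n
    obtain F where F: "?P n F" using * by blast
    have "fps_nth (sum f G) n = fps_nth S n" if "finite G" "F \<subseteq> G" "G \<subseteq> I" for G
      unfolding fps_sum_nth using F that by (subst sum.mono_neutral_right[of G F]) auto
    with F show "\<forall>\<^sub>F F in finite_subsets_at_top I. fps_nth (sum f F) n = fps_nth S n"
      unfolding eventually_finite_subsets_at_top by blast
  qed
qed

lemma summable_on_fpsI:
  fixes f :: "'i \<Rightarrow> 'a :: ab_group_add fps"
  assumes "\<And>n. finite {i \<in> I. fps_nth (f i) n \<noteq> 0}"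
  shows "f summable_on I"
  unfolding summable_on_def has_sum_fps_iff
proof (intro exI allI)
  fix n
  let ?F = "{i \<in> I. fps_nth (f i) n \<noteq> 0}"
  let ?S = "Abs_fps (\<lambda>n. \<Sum>i | i \<in> I \<and> fps_nth (f i) n \<noteq> 0. fps_nth (f i) n)"
  show "finite ?F \<and> ?F \<subseteq> I \<and> (\<forall>i\<in>I - ?F. fps_nth (f i) n = 0) \<and> fps_nth ?S n = (\<Sum>i\<in>?F. fps_nth (f i) n)"
    using assms[of n] by auto
qed

lemma has_sum_fps_nth:
  fixes f :: "'i \<Rightarrow> 'a :: ab_group_add fps"
  assumes "(f has_sum S) I"
  shows "finite {i \<in> I. fps_nth (f i) n \<noteq> 0}"
    and "fps_nth S n = (\<Sum>i | i \<in> I \<and> fps_nth (f i) n \<noteq> 0. fps_nth (f i) n)"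
proof -
  obtain F where F: "finite F" "F \<subseteq> I" "\<And>i. i \<in> I - F \<Longrightarrow> fps_nth (f i) n = 0"
    "fps_nth S n = (\<Sum>i\<in>F. fps_nth (f i) n)"
    using assms unfolding has_sum_fps_iff by metis
  have sub: "{i \<in> I. fps_nth (f i) n \<noteq> 0} \<subseteq> F" using F(3) by auto
  show "finite {i \<in> I. fps_nth (f i) n \<noteq> 0}" using finite_subset[OF sub F(1)] .
  show "fps_nth S n = (\<Sum>i | i \<in> I \<and> fps_nth (f i) n \<noteq> 0. fps_nth (f i) n)"
    unfolding F(4) using F by (intro sum.mono_neutral_right) auto
qed

text \<open>Only indices whose terms are nonzero in some degree up to \<open>n\<close> affect degree
  \<open>n\<close>; they form finite sets, so a product of two finite sums suffices.\<close>

lemma has_sum_fps_mult: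
  fixes f :: "'i \<Rightarrow> 'a :: comm_ring_1 fps"
  assumes f: "(f has_sum S) I" and g: "(g has_sum T) J"
  shows "((\<lambda>(i,j). f i * g j) has_sum S * T) (I \<times> J)"
  unfolding has_sum_fps_iff
proof
  fix n
  define F where "F = (\<Union>k\<le>n. {i \<in> I. fps_nth (f i) k \<noteq> 0})"
  define G where "G = (\<Union>k\<le>n. {j \<in> J. fps_nth (g j) k \<noteq> 0})"
  have fin: "finite F" "finite G" "F \<subseteq> I" "G \<subseteq> J"
    unfolding F_def G_def using has_sum_fps_nth(1)[OF f] has_sum_fps_nth(1)[OF g] by auto
  have S: "fps_nth S k = (\<Sum>i\<in>F. fps_nth (f i) k)" if "k \<le> n" for k
    unfolding has_sum_fps_nth(2)[OF f] using that fin by (intro sum.mono_neutral_left) (auto simp: F_def)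
  have T: "fps_nth T k = (\<Sum>i\<in>G. fps_nth (g i) k)" if "k \<le> n" for k
    unfolding has_sum_fps_nth(2)[OF g] using that fin by (intro sum.mono_neutral_left) (auto simp: G_def)
  have zero: "fps_nth (f i * g j) n = 0" if "i \<in> I" "j \<in> J" "(i, j) \<notin> F \<times> G" for i j
  proof -
    have "(\<forall>k\<le>n. fps_nth (f i) k = 0) \<or> (\<forall>k\<le>n. fps_nth (g j) k = 0)"
      using that by (auto simp: F_def G_def)
    then show ?thesis by (auto simp: fps_mult_nth intro!: sum.neutral)
  qed
  have "fps_nth (S * T) n = fps_nth ((\<Sum>i\<in>F. f i) * (\<Sum>j\<in>G. g j)) n"
    by (simp add: fps_mult_nth S T fps_sum_nth)
  also have "(\<Sum>i\<in>F. f i) * (\<Sum>j\<in>G. g j) = (\<Sum>x\<in>F\<times>G. case x of (i,j) \<Rightarrow> f i * g j)"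
    by (simp add: sum_product sum.cartesian_product)
  finally show "\<exists>F. finite F \<and> F \<subseteq> I \<times> J \<and> (\<forall>i\<in>I \<times> J - F. fps_nth (case i of (i, j) \<Rightarrow> f i * g j) n = 0) \<and>
             fps_nth (S * T) n = (\<Sum>i\<in>F. fps_nth (case i of (i, j) \<Rightarrow> f i * g j) n)"
    using fin zero by (intro exI[of _ "F \<times> G"]) (auto simp: fps_sum_nth)
qed

section \<open>Infinite products and theta series\<close>

lemma fps_nth_0_prod: "fps_nth (\<Prod>i\<in>I. f i) 0 = (\<Prod>i\<in>I. fps_nth (f i :: 'a :: comm_ring_1 fps) 0)"
  by (induction I rule: infinite_finite_induct) simp_all

text \<open>Factor \<open>k\<close> differs from 1 only in degrees above \<open>k\<close>, so the
  partial products stabilise.\<close>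

lemma qpoch_inf_fps:
  fixes A q :: "complex fps"
  assumes "fps_nth A 0 = 0" "fps_nth q 0 = 0" "A \<noteq> 0" "q \<noteq> 0"
  shows qpoch_inf_tendsto: "(\<lambda>n. \<Prod>k<n. 1 - A * q ^ k) \<longlonglongrightarrow> qpoch_inf A q"
    and qpoch_inf_nth_0: "fps_nth (qpoch_inf A q) 0 = 1"
proof -
  define f where "f = (\<lambda>k. 1 - A * q ^ k)"
  have nth0: "fps_nth (f k) 0 = 1" for k using assms(1) by (simp add: f_def)
  then have nz: "f k \<noteq> 0" for k by (metis fps_zero_nth zero_neq_one)
  have sub: "subdegree (f k - 1) > n" if "k > n" for n k
  proof -
    have "subdegree q \<ge> 1" "subdegree A \<ge> 1"
      using assms subdegree_eq_0_iff[of q] subdegree_eq_0_iff[of A] by (simp_all add: Suc_le_eq del: subdegree_eq_0_iff)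
    moreover have "subdegree (f k - 1) = subdegree A + k * subdegree q"
      using assms by (simp add: f_def)
    ultimately show ?thesis using that
      using mult_le_mono2[of 1 "subdegree q" k] by linarith
  qed
  obtain P where P: "(\<lambda>n. \<Prod>k\<le>n. f k) \<longlonglongrightarrow> P"
    using tendsto_prod_fps[of f "\<lambda>n. n", OF nz sub] by blast
  have "fps_nth P 0 = 1"
  proof -
    have "\<forall>\<^sub>F n in sequentially. fps_nth (\<Prod>k\<le>n. f k) 0 = fps_nth P 0"
      using P unfolding tendsto_fps_iff by blast
    then have "\<forall>\<^sub>F n::nat in sequentially. 1 = fps_nth P 0"
      unfolding fps_nth_0_prod nth0 by simp
    then show ?thesis by simp
  qed
  \<comment> \<open>\<open>has_prod\<close> demands a nonzero limit; the constant coefficient 1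
    provides it.\<close>
  then have "P \<noteq> 0" by auto
  with P have "f has_prod P" by (simp add: has_prod_def raw_has_prod_def)
  then have "qpoch_inf A q = P"
    unfolding qpoch_inf_def f_def[symmetric] using has_prod_unique by metis
  then show "fps_nth (qpoch_inf A q) 0 = 1" using \<open>fps_nth P 0 = 1\<close> by simp
  show "(\<lambda>n. \<Prod>k<n. 1 - A * q ^ k) \<longlonglongrightarrow> qpoch_inf A q"
    using P \<open>qpoch_inf A q = P\<close> filterlim_sequentially_Suc[of "\<lambda>n. \<Prod>k<n. f k" "nhds P"]
    by (simp add: f_def lessThan_Suc_atMost)
qed

lemma qpoch_inf_mult_neg:
  fixes A q :: "complex fps"
  assumes "fps_nth A 0 = 0" "fps_nth q 0 = 0" "A \<noteq> 0" "q \<noteq> 0"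
  shows "qpoch_inf A q * qpoch_inf (- A) q = qpoch_inf (A ^ 2) (q ^ 2)"
proof (rule LIMSEQ_unique)
  show "(\<lambda>n. (\<Prod>k<n. 1 - A * q ^ k) * (\<Prod>k<n. 1 - (-A) * q ^ k)) \<longlonglongrightarrow> qpoch_inf A q * qpoch_inf (- A) q"
    using assms by (intro tendsto_mult qpoch_inf_tendsto) auto
  have "(\<Prod>k<n. 1 - A * q ^ k) * (\<Prod>k<n. 1 - (-A) * q ^ k) = (\<Prod>k<n. 1 - A ^ 2 * (q ^ 2) ^ k)" for n
    by (simp add: prod.distrib[symmetric] algebra_simps power2_eq_square power_mult_distrib)
  then show "(\<lambda>n. (\<Prod>k<n. 1 - A * q ^ k) * (\<Prod>k<n. 1 - (-A) * q ^ k)) \<longlonglongrightarrow> qpoch_inf (A ^ 2) (q ^ 2)"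
    using assms by (simp only:) (intro qpoch_inf_tendsto, auto simp: power2_eq_square)
qed

text \<open>The partial product over \<open>k < 2 * n\<close> separates into even and odd
  \<open>k\<close>, and a subsequence has the same limit.\<close>

lemma qpoch_inf_split:
  fixes A q :: "complex fps"
  assumes "fps_nth A 0 = 0" "fps_nth q 0 = 0" "A \<noteq> 0" "q \<noteq> 0"
  shows "qpoch_inf A q = qpoch_inf A (q ^ 2) * qpoch_inf (A * q) (q ^ 2)"
proof (rule LIMSEQ_unique)
  have "strict_mono (\<lambda>n::nat. 2 * n)" by (simp add: strict_mono_def)
  from LIMSEQ_subseq_LIMSEQ[OF qpoch_inf_tendsto[OF assms] this]
  show "(\<lambda>n. \<Prod>k<2*n. 1 - A * q ^ k) \<longlonglongrightarrow> qpoch_inf A q" by (simp add: o_def)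
  have "(\<Prod>k<2*n. 1 - A * q ^ k) = (\<Prod>k<n. 1 - A * (q ^ 2) ^ k) * (\<Prod>k<n. 1 - (A * q) * (q ^ 2) ^ k)" for n
    by (induction n) (simp_all add: algebra_simps power_mult[symmetric])
  then show "(\<lambda>n. \<Prod>k<2*n. 1 - A * q ^ k) \<longlonglongrightarrow> qpoch_inf A (q ^ 2) * qpoch_inf (A * q) (q ^ 2)"
    using assms by (simp only:) (intro tendsto_mult qpoch_inf_tendsto, auto simp: power2_eq_square)
qed

section \<open>Terms of the general theta series\<close>

definition tri :: "int \<Rightarrow> nat" where
  "tri m = nat (m * (m + 1) div 2)"

lemma two_tri: "2 * int (tri m) = m * (m + 1)"
proof -
  have "m * (m + 1) \<ge> 0" by (cases "m \<ge> 0") (auto simp: mult_nonpos_nonpos)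
  then show ?thesis by (simp add: tri_def)
qed

lemma tri_diff: "int (tri m) = int (tri (m - 1)) + m"
  using two_tri[of m] two_tri[of "m - 1"] by (simp add: algebra_simps)

text \<open>The general term of Ramanujan's theta function \<open>f(a, b)\<close>; avoiding \<open>z\<close> and \<open>1 / z\<close> keeps all exponents natural.\<close>

definition theta_term :: "complex fps \<Rightarrow> complex fps \<Rightarrow> int \<Rightarrow> complex fps" where
  "theta_term a b m = a ^ tri m * b ^ tri (- m)"

text \<open>Index shift for the induction in the finite triple product; the hypothesis keeps the
  exponent \<open>int n + 1 - m\<close> nonnegative.\<close>

lemma theta_term_shift_up:
  assumes "m \<le> int n + 1"
  shows "a * (a * b) ^ n * theta_term a b (m - 1) = (a * b) ^ nat (int n + 1 - m) * theta_term a b m"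
proof -
  have "1 + n + tri (m - 1) = nat (int n + 1 - m) + tri m" "n + tri (1 - m) = nat (int n + 1 - m) + tri (- m)"
  proof -
    have "int (nat (int n + 1 - m)) = int n + 1 - m" using assms by simp
    moreover have "int (tri (1 - m)) = int (tri (- m)) + (1 - m)" using tri_diff[of "1 - m"] by simp
    ultimately show "1 + n + tri (m - 1) = nat (int n + 1 - m) + tri m" "n + tri (1 - m) = nat (int n + 1 - m) + tri (- m)"
      using tri_diff[of m] by linarith+
  qed
  note e = this
  have "a * (a * b) ^ n * theta_term a b (m - 1) = a ^ (1 + n + tri (m - 1)) * b ^ (n + tri (1 - m))"
    by (simp add: theta_term_def power_mult_distrib power_add)
  also have "\<dots> = (a * b) ^ nat (int n + 1 - m) * theta_term a b m"
    unfolding e by (simp add: theta_term_def power_mult_distrib power_add)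
  finally show ?thesis .
qed

lemma theta_term_minus: "theta_term a b (- m) = theta_term b a m"
  by (simp add: theta_term_def)

lemma theta_term_shift_down:
  assumes "m \<ge> - int n - 1"
  shows "b * (a * b) ^ n * theta_term a b (m + 1) = (a * b) ^ nat (int n + 1 + m) * theta_term a b m"
  using theta_term_shift_up[of "- m" n b a] assms theta_term_minus[of b a "m + 1"] theta_term_minus[of b a m]
  by (simp add: mult.commute[of b a])

lemma abs_le_power2: "\<bar>l\<bar> \<le> l ^ 2" for l :: int
proof (cases "l = 0")
  case False
  then have "1 \<le> \<bar>l\<bar>" by linarith
  then show ?thesis using self_le_power[of "\<bar>l\<bar>" 2] by simp
qed simp

text \<open>Both \<open>a\<close> and \<open>b\<close> are divisible by \<open>fps_X\<close>, so the
  term has order at least \<open>tri m + tri (- m)\<close>, which is the square of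
  \<open>m\<close>.\<close>

lemma theta_term_nth_eq_0:
  assumes "fps_nth a 0 = 0" "fps_nth b 0 = 0" "n < nat \<bar>m\<bar>"
  shows "fps_nth (theta_term a b m) n = 0"
proof -
  have "int (tri m + tri (- m)) = m * m" using two_tri[of m] two_tri[of "- m"] by (simp add: algebra_simps)
  moreover have "\<bar>m\<bar> \<le> m * m" using abs_le_power2[of m] by (simp add: power2_eq_square)
  ultimately have "n < tri m + tri (- m)" using assms by linarith
  moreover have "fps_X ^ (tri m + tri (- m)) dvd theta_term a b m"
  proof -
    have "fps_X dvd c" if "fps_nth c 0 = 0" for c :: "complex fps"
      
    proof (cases "c = 0")
      case False
      then have "fps_shift 1 c * fps_X = c"
        using that subdegree_eq_0_iff[of c] by (intro fps_shift_times_fps_X) (simp add: Suc_le_eq del: subdegree_eq_0_iff)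
      then show ?thesis by (metis dvd_triv_right)
    qed simp
    then have "fps_X dvd a" "fps_X dvd b" using assms by auto
    then show ?thesis unfolding theta_term_def power_add
      by (intro mult_dvd_mono dvd_power_same)
  qed
  ultimately show ?thesis by (auto elim!: dvdE simp: fps_X_power_mult_nth)
qed

lemma theta_summable:
  assumes "fps_nth a 0 = 0" "fps_nth b 0 = 0"
  shows "theta_term a b summable_on UNIV"
proof (rule summable_on_fpsI)
  fix n
  show "finite {i \<in> UNIV. fps_nth (theta_term a b i) n \<noteq> 0}"
  proof (rule finite_subset)
    show "{i \<in> UNIV. fps_nth (theta_term a b i) n \<noteq> 0} \<subseteq> {- int n..int n}"
    proof
      fix i assume "i \<in> {i \<in> UNIV. fps_nth (theta_term a b i) n \<noteq> 0}"
      then have "\<not> n < nat \<bar>i\<bar>" using theta_term_nth_eq_0[OF assms] by blast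
      then show "i \<in> {- int n..int n}" by auto
    qed
  qed simp
qed

section \<open>The Jacobi triple product\<close>

text \<open>The factors are written \<open>p * p ^ k\<close> so that these are literally the partial
  products of \<open>qpoch_inf p p\<close>.\<close>

definition qfact :: "complex fps \<Rightarrow> nat \<Rightarrow> complex fps" where
  "qfact p n = (\<Prod>k<n. 1 - p * p ^ k)"

lemma qfact_Suc: "qfact p (Suc n) = qfact p n * (1 - p ^ Suc n)"
  by (simp add: qfact_def)

lemma qfact_nth_0: "fps_nth p 0 = 0 \<Longrightarrow> fps_nth (qfact p n) 0 = 1"
  by (simp add: qfact_def fps_nth_0_prod)

text \<open>Expressing the inverse at \<open>n\<close> by the one at \<open>Suc n\<close> lets
  neighbouring Gaussian coefficients share a common factor.\<close>

lemma inverse_qfact_Suc: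
  assumes "fps_nth p 0 = 0"
  shows "inverse (qfact p n) = inverse (qfact p (Suc n)) * (1 - p ^ Suc n)"
proof -
  have "inverse (qfact p (Suc n)) * (1 - p ^ Suc n) =
    inverse (qfact p n) * (inverse (1 - p ^ Suc n) * (1 - p ^ Suc n))"
    by (simp add: qfact_Suc fps_inverse_mult mult.assoc del: power_Suc)
  also have "inverse (1 - p ^ Suc n) * (1 - p ^ Suc n) = 1"
    using assms by (intro inverse_mult_eq_1) simp
  finally show ?thesis by simp
qed

text \<open>The central Gaussian binomial \<open>[2 n; n + m]\<close>, extended by 0.\<close>

definition gauss_coeff :: "complex fps \<Rightarrow> nat \<Rightarrow> int \<Rightarrow> complex fps" where
  "gauss_coeff p n m = (if \<bar>m\<bar> \<le> int n then
     qfact p (2 * n) * inverse (qfact p (nat (int n - m))) * inverse (qfact p (nat (int n + m))) else 0)"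

lemma gauss_coeff_top:
  assumes "fps_nth p 0 = 0" "\<bar>m\<bar> = int n"
  shows "gauss_coeff p n m = 1"
proof -
  have "nat (int n - m) = 0 \<and> nat (int n + m) = 2 * n \<or> nat (int n - m) = 2 * n \<and> nat (int n + m) = 0"
    using assms(2) by linarith
  moreover have "qfact p (2 * n) * inverse (qfact p (2 * n)) = 1"
    using qfact_nth_0[OF assms(1), of "2 * n"] by (intro inverse_mult_eq_1') simp
  moreover have "qfact p 0 = 1" by (simp add: qfact_def)
  ultimately show ?thesis using assms(2) by (auto simp: gauss_coeff_def)
qed

text \<open>Two steps of the q-Pascal rule, in the form dictated by the expansion of
  \<open>(1 + a * p ^ n) * (1 + b * p ^ n)\<close>. Once a common factor is extracted it is a
  polynomial identity.\<close>

lemma gauss_coeff_Suc: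
  assumes p: "fps_nth p 0 = 0" and m: "\<bar>m\<bar> \<le> int n + 1"
  shows "gauss_coeff p (Suc n) m = (1 + p ^ (2 * n + 1)) * gauss_coeff p n m
    + p ^ nat (int n + 1 - m) * gauss_coeff p n (m - 1) + p ^ nat (int n + 1 + m) * gauss_coeff p n (m + 1)"
proof (cases "\<bar>m\<bar> = int n + 1")
  \<comment> \<open>At the border only one of the three coefficients on the right survives, and it
    equals 1.\<close>
  case True
  then have top: "gauss_coeff p (Suc n) m = 1" by (intro gauss_coeff_top p) simp
  have zero: "gauss_coeff p n m = 0" using True by (simp add: gauss_coeff_def)
  show ?thesis
  proof (cases "m \<ge> 0")
    case True
    with \<open>\<bar>m\<bar> = int n + 1\<close> have "gauss_coeff p n (m + 1) = 0" "gauss_coeff p n (m - 1) = 1" "nat (int n + 1 - m) = 0"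
      by (simp_all add: gauss_coeff_top p) (simp add: gauss_coeff_def)
    then show ?thesis by (simp add: top zero)
  next
    case False
    with \<open>\<bar>m\<bar> = int n + 1\<close> have "gauss_coeff p n (m - 1) = 0" "gauss_coeff p n (m + 1) = 1" "nat (int n + 1 + m) = 0"
      by (simp_all add: gauss_coeff_top p) (simp add: gauss_coeff_def)
    then show ?thesis by (simp add: top zero)
  qed
next
  case False
  with m have m: "\<bar>m\<bar> \<le> int n" by simp
  define u v where "u = nat (int n - m)" and "v = nat (int n + m)"
  have uv: "int u = int n - m" "int v = int n + m" "2 * n = u + v"
    using m by (auto simp: u_def v_def)
  define I where "I = (\<lambda>n. inverse (qfact p n))"
  have I_Suc: "I n = I (Suc n) * (1 - p ^ Suc n)" for n
    unfolding I_def by (rule inverse_qfact_Suc[OF p])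
  define x y where "x = p ^ u" and "y = p ^ v"
  \<comment> \<open>With the larger inverses collected in \<open>K\<close>, all four coefficients
    are \<open>K\<close> times a polynomial in \<open>p\<close>, \<open>x\<close>,
    \<open>y\<close>.\<close>
  define K where "K = qfact p (u + v) * I (Suc u) * I (Suc v)"
  have n0: "nat (int (Suc n) - m) = Suc u" "nat (int (Suc n) + m) = Suc v" "2 * Suc n = Suc (Suc (u + v))"
    using uv by auto
  have "gauss_coeff p (Suc n) m = qfact p (Suc (Suc (u + v))) * I (Suc u) * I (Suc v)"
    using m unfolding gauss_coeff_def n0 I_def by simp
  then have g1: "gauss_coeff p (Suc n) m = K * (1 - p * x * y) * (1 - p * p * x * y)"
    by (simp add: qfact_Suc K_def x_def y_def power_add mult_ac)
  have "gauss_coeff p n m = qfact p (u + v) * I u * I v"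
    using m uv unfolding gauss_coeff_def I_def u_def[symmetric] v_def[symmetric] by simp
  then have g2: "gauss_coeff p n m = K * (1 - p * x) * (1 - p * y)"
    by (simp add: I_Suc[of u] I_Suc[of v] K_def x_def y_def)
  have g3: "gauss_coeff p n (m - 1) = K * (1 - y) * (1 - p * y)"
  proof (cases v)
    \<comment> \<open>The index \<open>m - 1\<close> leaves the range here, in agreement with the
      factor \<open>1 - y = 0\<close>.\<close>
    case 0
    then have "gauss_coeff p n (m - 1) = 0" using uv by (simp add: gauss_coeff_def)
    moreover have "y = 1" using 0 by (simp add: y_def)
    ultimately show ?thesis by simp
  next
    case (Suc w)
    then have "nat (int n - (m - 1)) = Suc u" "nat (int n + (m - 1)) = w" "\<bar>m - 1\<bar> \<le> int n" "2 * n = u + v"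
      using uv by auto
    then have "gauss_coeff p n (m - 1) = qfact p (u + v) * I (Suc u) * I w"
      unfolding gauss_coeff_def I_def by simp
    then show ?thesis by (simp add: I_Suc[of w] I_Suc[of "Suc w"] K_def y_def Suc)
  qed
  have g4: "gauss_coeff p n (m + 1) = K * (1 - x) * (1 - p * x)"
  proof (cases u)
    case 0
    then have "gauss_coeff p n (m + 1) = 0" using uv by (simp add: gauss_coeff_def)
    moreover have "x = 1" using 0 by (simp add: x_def)
    ultimately show ?thesis by simp
  next
    case (Suc w)
    then have "nat (int n - (m + 1)) = w" "nat (int n + (m + 1)) = Suc v" "\<bar>m + 1\<bar> \<le> int n" "2 * n = u + v"
      using uv by auto
    then have "gauss_coeff p n (m + 1) = qfact p (u + v) * I w * I (Suc v)"
      unfolding gauss_coeff_def I_def by simp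
    then show ?thesis by (simp add: I_Suc[of w] I_Suc[of "Suc w"] K_def x_def Suc)
  qed
  have e: "p ^ nat (int n + 1 - m) = p * x" "p ^ nat (int n + 1 + m) = p * y" "p ^ (2 * n + 1) = p * x * y"
  proof -
    have "nat (int n + 1 - m) = Suc u" "nat (int n + 1 + m) = Suc v" "2 * n + 1 = Suc (u + v)" using uv by auto
    then show "p ^ nat (int n + 1 - m) = p * x" "p ^ nat (int n + 1 + m) = p * y" "p ^ (2 * n + 1) = p * x * y"
      by (simp_all add: x_def y_def power_add)
  qed
  show ?thesis unfolding g1 g2 g3 g4 e by (simp add: algebra_simps)
qed

text \<open>By induction: the new factor expands to \<open>1 + p ^ (2 * n + 1)\<close> plus two
  monomials that shift the index up or down by one, and after reindexing the coefficients combine by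
  \<open>gauss_coeff_Suc\<close>.\<close>

lemma finite_jacobi_triple_product:
  assumes "fps_nth (a * b) 0 = 0"
  shows "(\<Prod>k<n. (1 + a * (a * b) ^ k) * (1 + b * (a * b) ^ k)) =
    (\<Sum>m=-int n..int n. gauss_coeff (a * b) n m * theta_term a b m)"
proof (induction n)
  case 0
  show ?case using gauss_coeff_top[OF assms, of 0 0] by (simp add: theta_term_def tri_def)
next
  case (Suc n)
  define p where "p = a * b"
  define G where "G = gauss_coeff p n"
  define t where "t = theta_term a b"
  let ?J = "{-int (Suc n)..int (Suc n)}"
  have ext: "(\<Sum>m=-int n..int n. G m * f m) = (\<Sum>m\<in>?J. G m * f m)" for f
    by (rule sum.mono_neutral_left) (auto simp: G_def gauss_coeff_def)
  have "(\<Sum>m=-int n..int n. G m * (a * p ^ n * t m)) = (\<Sum>m=-int n+1..int n+1. G (m - 1) * (a * p ^ n * t (m - 1)))"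
    by (rule sum.reindex_bij_witness[of _ "\<lambda>m. m - 1" "\<lambda>m. m + 1"]) auto
  also have "\<dots> = (\<Sum>m\<in>?J. G (m - 1) * (a * p ^ n * t (m - 1)))"
    by (rule sum.mono_neutral_left) (auto simp: G_def gauss_coeff_def)
  also have "\<dots> = (\<Sum>m\<in>?J. p ^ nat (int n + 1 - m) * G (m - 1) * t m)"
    unfolding p_def t_def by (intro sum.cong refl, subst theta_term_shift_up) (auto simp: mult_ac)
  finally have up: "(\<Sum>m=-int n..int n. G m * (a * p ^ n * t m)) = (\<Sum>m\<in>?J. p ^ nat (int n + 1 - m) * G (m - 1) * t m)" .
  have "(\<Sum>m=-int n..int n. G m * (b * p ^ n * t m)) = (\<Sum>m=-int n-1..int n-1. G (m + 1) * (b * p ^ n * t (m + 1)))"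
    by (rule sum.reindex_bij_witness[of _ "\<lambda>m. m + 1" "\<lambda>m. m - 1"]) auto
  also have "\<dots> = (\<Sum>m\<in>?J. G (m + 1) * (b * p ^ n * t (m + 1)))"
    by (rule sum.mono_neutral_left) (auto simp: G_def gauss_coeff_def)
  also have "\<dots> = (\<Sum>m\<in>?J. p ^ nat (int n + 1 + m) * G (m + 1) * t m)"
    unfolding p_def t_def by (intro sum.cong refl, subst theta_term_shift_down) (auto simp: mult_ac)
  finally have down: "(\<Sum>m=-int n..int n. G m * (b * p ^ n * t m)) = (\<Sum>m\<in>?J. p ^ nat (int n + 1 + m) * G (m + 1) * t m)" .
  have "(\<Prod>k<Suc n. (1 + a * p ^ k) * (1 + b * p ^ k)) =
    (\<Sum>m=-int n..int n. G m * t m) * ((1 + a * p ^ n) * (1 + b * p ^ n))"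
    using Suc unfolding p_def G_def t_def by simp
  also have "(1 + a * p ^ n) * (1 + b * p ^ n) = (1 + p ^ (2 * n + 1)) + a * p ^ n + b * p ^ n"
  proof -
    have "p ^ (2 * n + 1) = a * p ^ n * (b * p ^ n)"
      by (simp only: mult_2 power_add power_one_right) (simp add: p_def mult_ac)
    then show ?thesis by (simp add: algebra_simps)
  qed
  also have "(\<Sum>m=-int n..int n. G m * t m) * \<dots> =
    (\<Sum>m=-int n..int n. G m * ((1 + p ^ (2 * n + 1)) * t m)) + (\<Sum>m=-int n..int n. G m * (a * p ^ n * t m))
     + (\<Sum>m=-int n..int n. G m * (b * p ^ n * t m))"
    unfolding sum_distrib_right sum.distrib[symmetric] by (intro sum.cong refl) (simp add: algebra_simps)
  also have "\<dots> = (\<Sum>m\<in>?J. gauss_coeff p (Suc n) m * t m)"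
    unfolding up down ext sum.distrib[symmetric]
    by (intro sum.cong refl, subst gauss_coeff_Suc) (use assms in \<open>auto simp: p_def G_def algebra_simps\<close>)
  finally show ?case unfolding p_def t_def .
qed

text \<open>Limit of the finite identity multiplied by \<open>E = qpoch_inf p p\<close>: each
  Gaussian coefficient tends to \<open>inverse E\<close>.\<close>

theorem jacobi_triple_product:
  assumes a: "fps_nth a 0 = 0" "a \<noteq> 0" and b: "fps_nth b 0 = 0" "b \<noteq> 0"
  shows "(theta_term a b has_sum
    qpoch_inf (- a) (a * b) * qpoch_inf (- b) (a * b) * qpoch_inf (a * b) (a * b)) UNIV"
proof -
  define p where "p = a * b"
  have p: "fps_nth p 0 = 0" "p \<noteq> 0" using a b by (simp_all add: p_def)
  define E where "E = qpoch_inf p p"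
  define F where "F = qpoch_inf (- a) p * qpoch_inf (- b) p"
  obtain S where S: "(theta_term a b has_sum S) UNIV"
    using theta_summable[OF a(1) b(1)] unfolding summable_on_def by blast
  have E0: "fps_nth E 0 = 1" unfolding E_def using p by (intro qpoch_inf_nth_0) auto
  have lim_fact: "qfact p \<longlonglongrightarrow> E"
    unfolding E_def qfact_def using p by (intro qpoch_inf_tendsto) auto
  define P where "P = (\<lambda>n. (\<Prod>k<n. (1 + a * p ^ k) * (1 + b * p ^ k)))"
  have "P \<longlonglongrightarrow> F"
  proof -
    have "(\<lambda>n. (\<Prod>k<n. 1 - (-a) * p ^ k) * (\<Prod>k<n. 1 - (-b) * p ^ k)) \<longlonglongrightarrow> F"
      unfolding F_def using a b p by (intro tendsto_mult qpoch_inf_tendsto) auto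
    then show ?thesis by (simp add: P_def prod.distrib)
  qed
  then have lim1: "(\<lambda>n. E * P n) \<longlonglongrightarrow> E * F" by (intro tendsto_mult tendsto_const)
  have coeff: "(\<lambda>n. E * gauss_coeff p n m) \<longlonglongrightarrow> 1" for m
  proof -
    have inf: "filterlim (\<lambda>n. nat (int n + c)) at_top at_top" for c
      by (rule filterlim_at_top_mono[where f = "\<lambda>n. n - nat (- c)"])
        (simp_all add: filterlim_minus_const_nat_at_top, intro always_eventually allI, linarith)
    have l1: "(\<lambda>n. qfact p (2 * n)) \<longlonglongrightarrow> E"
      by (rule filterlim_compose[OF lim_fact]) (simp add: mult_nat_left_at_top)
    have l2: "(\<lambda>n. inverse (qfact p (nat (int n + c)))) \<longlonglongrightarrow> inverse E" for c
      by (intro tendsto_inverse_fps filterlim_compose[OF lim_fact] inf) (simp add: E0)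
    have "(\<lambda>n. E * (qfact p (2 * n) * inverse (qfact p (nat (int n + (- m)))) * inverse (qfact p (nat (int n + m)))))
       \<longlonglongrightarrow> E * (E * inverse E * inverse E)"
      by (intro tendsto_mult tendsto_const l1 l2)
    also have "E * (E * inverse E * inverse E) = 1"
    proof -
      have "E * inverse E = 1" using E0 by (intro inverse_mult_eq_1') simp
      then show ?thesis by (simp add: mult.assoc)
    qed
    finally show ?thesis
    proof (rule Lim_transform_eventually)
      show "\<forall>\<^sub>F n in sequentially. E * (qfact p (2 * n) * inverse (qfact p (nat (int n + (- m)))) * inverse (qfact p (nat (int n + m))))
        = E * gauss_coeff p n m"
        using eventually_ge_at_top[of "nat \<bar>m\<bar>"] by eventually_elim (auto simp: gauss_coeff_def)
    qed
  qed
  \<comment> \<open>In degree \<open>N\<close> only the indices with absolute value at most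
    \<open>N\<close> contribute, so finitely many of the limits \<open>coeff\<close>
    suffice.\<close>
  have lim2: "(\<lambda>n. E * P n) \<longlonglongrightarrow> S"
    unfolding tendsto_fps_iff
  proof
    fix N :: nat
    have t0: "fps_nth (theta_term a b m) k = 0" if "k \<le> N" "\<bar>m\<bar> > int N" for m k
      using that by (intro theta_term_nth_eq_0[OF a(1) b(1)]) linarith
    obtain X where X: "finite X" "\<And>m. m \<in> UNIV - X \<Longrightarrow> fps_nth (theta_term a b m) N = 0"
      "fps_nth S N = (\<Sum>i\<in>X. fps_nth (theta_term a b i) N)"
      using S unfolding has_sum_fps_iff by metis
    have SN: "fps_nth S N = (\<Sum>m\<in>{-int N..int N}. fps_nth (theta_term a b m) N)"
      unfolding X(3) using X(1,2) t0[of N] by (intro sum.mono_neutral_cong) auto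
    have "(\<lambda>n. E * gauss_coeff p n m * theta_term a b m) \<longlonglongrightarrow> 1 * theta_term a b m" for m
      by (intro tendsto_mult tendsto_const coeff)
    then have "\<forall>\<^sub>F n in sequentially. \<forall>m\<in>{-int N..int N}.
        fps_nth (E * gauss_coeff p n m * theta_term a b m) N = fps_nth (theta_term a b m) N"
      unfolding tendsto_fps_iff by (intro eventually_ball_finite) auto
    then show "\<forall>\<^sub>F n in sequentially. fps_nth (E * P n) N = fps_nth S N"
      using eventually_ge_at_top[of N]
    proof eventually_elim
      case (elim n)
      have "E * P n = (\<Sum>m=-int n..int n. E * gauss_coeff p n m * theta_term a b m)"
        using p(1) unfolding P_def p_def
        by (subst finite_jacobi_triple_product) (simp_all add: sum_distrib_left mult.assoc)
      then have "fps_nth (E * P n) N = (\<Sum>m=-int n..int n. fps_nth (E * gauss_coeff p n m * theta_term a b m) N)"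
        by (simp add: fps_sum_nth)
      also have "\<dots> = (\<Sum>m=-int N..int N. fps_nth (E * gauss_coeff p n m * theta_term a b m) N)"
        using elim(2) t0 by (intro sum.mono_neutral_right) (auto simp: fps_mult_nth intro!: sum.neutral)
      also have "\<dots> = (\<Sum>m=-int N..int N. fps_nth (theta_term a b m) N)"
        using elim(1) by (intro sum.cong) auto
      finally show ?case by (simp add: SN)
    qed
  qed
  have "S = E * F" using LIMSEQ_unique[OF lim2 lim1] .
  with S show ?thesis by (simp add: E_def F_def p_def mult_ac)
qed

section \<open>The square of a theta series\<close>

lemma tri_add_tri_minus: "tri m + tri (- m) = nat (m ^ 2)"
  using two_tri[of m] two_tri[of "- m"] by (simp add: algebra_simps power2_eq_square)

lemma theta_term_mult_left: "theta_term x (x * z) m = x ^ nat (m ^ 2) * z ^ tri (- m)"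
  by (simp add: theta_term_def power_mult_distrib power_add mult_ac flip: tri_add_tri_minus)

lemma theta_term_mult_right: "theta_term z (x * z) m = z ^ nat (m ^ 2) * x ^ tri (- m)"
  by (simp add: theta_term_def power_mult_distrib power_add mult_ac flip: tri_add_tri_minus)

text \<open>Passing to sums and differences of \<open>i\<close> and \<open>j\<close> separates the
  quadratic exponents of the double sum. In the application \<open>x ^ 2 * z\<close> is
  \<open>P\<close>, hence \<open>A\<close> and \<open>B\<close> are series in \<open>P\<close>; the
  parameters \<open>x\<close> and \<open>z\<close> avoid negative exponents.\<close>

lemma theta_square:
  fixes x z :: "complex fps"
  assumes f: "(theta_term x (x * z) has_sum F) UNIV"
    and g: "(theta_term (x ^ 2) (x ^ 2 * z ^ 2) has_sum G) UNIV"
    and h: "(theta_term z (x ^ 4 * z) has_sum H) UNIV"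
    and A: "((\<lambda>l. (x ^ 2 * z) ^ nat (l ^ 2)) has_sum A) UNIV"
    and B: "((\<lambda>l. (x ^ 2 * z) ^ nat (l * (l + 1))) has_sum B) UNIV"
  shows "F ^ 2 = A * G + x * (B * H)"
proof -
  let ?E = "{p :: int \<times> int. even (fst p + snd p)}"
  let ?t = "\<lambda>(i, j). theta_term x (x * z) i * theta_term x (x * z) j"
  have nn: "0 \<le> i * (i + 1)" for i :: int using two_tri[of i] by linarith
  have i1: "nat ((l + k)\<^sup>2) + nat ((k - l)\<^sup>2) = 2 * nat (l\<^sup>2) + 2 * nat (k\<^sup>2)" for k l :: int
  proof -
    have "int (nat ((l + k)\<^sup>2) + nat ((k - l)\<^sup>2)) = int (2 * nat (l\<^sup>2) + 2 * nat (k\<^sup>2))"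
      by simp (simp add: power2_eq_square algebra_simps)
    then show ?thesis by linarith
  qed
  \<comment> \<open>\<open>tri\<close> hides a division by 2, so the identity is checked after
    doubling.\<close>
  have i2: "tri (- (l + k)) + tri (- (k - l)) = nat (l\<^sup>2) + 2 * tri (- k)" for k l :: int
  proof -
    have "2 * int (tri (- (l + k)) + tri (- (k - l))) = 2 * int (nat (l\<^sup>2) + 2 * tri (- k))"
      using two_tri[of "- (l + k)"] two_tri[of "- (k - l)"] two_tri[of "- k"]
      by (simp add: power2_eq_square algebra_simps)
    then show ?thesis by (simp only: mult_cancel_left of_nat_eq_iff) simp
  qed
  have sq: "int (nat (i ^ 2)) = i ^ 2" and nat_nn: "int (nat (i * (i + 1))) = i * (i + 1)" for i :: int
    using nn[of i] by simp_all
  have i3: "nat ((l - k + 1)\<^sup>2) + nat ((- k - l)\<^sup>2) = 1 + 2 * nat (l * (l + 1)) + (4 * tri (- k))" for k l :: int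
  proof -
    have "2 * int (nat ((l - k + 1)\<^sup>2) + nat ((- k - l)\<^sup>2)) = 2 * int (1 + 2 * nat (l * (l + 1)) + 4 * tri (- k))"
      using two_tri[of "- k"]
      by (simp only: of_nat_add of_nat_mult of_nat_1 of_nat_numeral sq nat_nn) (simp add: power2_eq_square algebra_simps)
    then show ?thesis by (simp only: mult_cancel_left of_nat_eq_iff) simp
  qed
  have i4: "tri (- (l - k + 1)) + tri (- (- k - l)) = nat (l * (l + 1)) + nat (k\<^sup>2)" for k l :: int
  proof -
    have "2 * int (tri (- (l - k + 1)) + tri (- (- k - l))) = 2 * int (nat (l * (l + 1)) + nat (k\<^sup>2))"
      using two_tri[of "- (l - k + 1)"] two_tri[of "- (- k - l)"]
      by (simp only: of_nat_add of_nat_mult of_nat_1 of_nat_numeral sq nat_nn) (simp add: power2_eq_square algebra_simps)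
    then show ?thesis by (simp only: mult_cancel_left of_nat_eq_iff) simp
  qed
  \<comment> \<open>Pairs \<open>(i, j)\<close> are split by the parity of \<open>i + j\<close>.\<close>
  have ev: "(x ^ 2 * z) ^ nat (l ^ 2) * theta_term (x ^ 2) (x ^ 2 * z ^ 2) k = ?t (l + k, k - l)" for l k
  proof -
    have "?t (l + k, k - l) = x ^ (nat ((l + k)\<^sup>2) + nat ((k - l)\<^sup>2)) * z ^ (tri (- (l + k)) + tri (- (k - l)))"
      by (simp add: theta_term_mult_left power_add mult_ac)
    also have "\<dots> = (x ^ 2 * z) ^ nat (l ^ 2) * theta_term (x ^ 2) (x ^ 2 * z ^ 2) k"
      unfolding i1 i2 theta_term_mult_left by (simp add: power_add power_mult_distrib mult_ac flip: power_mult)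
    finally show ?thesis by simp
  qed
  \<comment> \<open>Here \<open>i + j = 1 - 2 * k\<close> and \<open>i - j = 2 * l + 1\<close>; this
    sign of \<open>k\<close> orients the second theta series as
    \<open>theta_term z (x ^ 4 * z)\<close>.\<close>
  have od: "x * ((x ^ 2 * z) ^ nat (l * (l + 1)) * theta_term z (x ^ 4 * z) k) = ?t (l - k + 1, - k - l)" for l k
  proof -
    have "?t (l - k + 1, - k - l) = x ^ (nat ((l - k + 1)\<^sup>2) + nat ((- k - l)\<^sup>2)) * z ^ (tri (- (l - k + 1)) + tri (- (- k - l)))"
      by (simp add: theta_term_mult_left power_add mult_ac)
    also have "\<dots> = x * ((x ^ 2 * z) ^ nat (l * (l + 1)) * theta_term z (x ^ 4 * z) k)"
      unfolding i3 i4 theta_term_mult_right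
      by (simp add: power_add power_mult_distrib distrib_left mult_ac flip: power_mult)
    finally show ?thesis by simp
  qed
  have ar1: "even i = even j \<Longrightarrow> (i - j) div 2 + (i + j) div 2 = i"
    "even i = even j \<Longrightarrow> (i + j) div 2 - (i - j) div 2 = j" for i j :: int by presburger+
  have "((\<lambda>(l, k). (x ^ 2 * z) ^ nat (l ^ 2) * theta_term (x ^ 2) (x ^ 2 * z ^ 2) k) has_sum A * G) (UNIV \<times> UNIV)"
    by (rule has_sum_fps_mult[OF A g])
  also have "?this \<longleftrightarrow> (?t has_sum A * G) ?E"
    by (rule has_sum_reindex_bij_witness[where j = "\<lambda>(l, k). (l + k, k - l)" and i = "\<lambda>(i, j). ((i - j) div 2, (i + j) div 2)"])
      (auto simp: ev[simplified] simp: ar1)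
  finally have 1: "(?t has_sum A * G) ?E" .
  have "((\<lambda>(l, k). (x ^ 2 * z) ^ nat (l * (l + 1)) * theta_term z (x ^ 4 * z) k) has_sum B * H) (UNIV \<times> UNIV)"
    by (rule has_sum_fps_mult[OF B h])
  then have "((\<lambda>p. x * (case p of (l, k) \<Rightarrow> (x ^ 2 * z) ^ nat (l * (l + 1)) * theta_term z (x ^ 4 * z) k)) has_sum x * (B * H)) (UNIV \<times> UNIV)"
    by (rule has_sum_cmult_right)
  also have "?this \<longleftrightarrow> (?t has_sum x * (B * H)) (- ?E)"
  proof (rule has_sum_reindex_bij_witness[where j = "\<lambda>(l, k). (l - k + 1, - k - l)"
        and i = "\<lambda>(i, j). ((i - j - 1) div 2, (1 - i - j) div 2)"], goal_cases)
    case (3 p)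
    then have "odd (fst p + snd p)" by simp
    then have "(fst p - snd p - 1) div 2 - (1 - fst p - snd p) div 2 + 1 = fst p"
      "- ((1 - fst p - snd p) div 2) - (fst p - snd p - 1) div 2 = snd p" by presburger+
    then show ?case by (simp only: case_prod_beta prod_eq_iff fst_conv snd_conv)
  qed (auto simp: od[simplified])
  finally have 2: "(?t has_sum x * (B * H)) (- ?E)" .
  have "(?t has_sum A * G + x * (B * H)) (?E \<union> - ?E)"
    by (rule has_sum_Un_disjoint[OF 1 2]) auto
  then have "(?t has_sum A * G + x * (B * H)) (UNIV \<times> UNIV)" by (simp add: Un_commute)
  moreover have "(?t has_sum F * F) (UNIV \<times> UNIV)"
    by (rule has_sum_fps_mult[OF f f])
  ultimately show ?thesis using has_sum_unique by (metis power2_eq_square)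
qed

section \<open>Lambert series as theta quotients\<close>

definition sgn_alt :: "int \<Rightarrow> complex fps" where
  "sgn_alt m = (if even m then 1 else - 1)"

lemma sgn_alt_simps [simp]: "sgn_alt 0 = 1" "sgn_alt (m + 1) = - sgn_alt m" "sgn_alt (m - 1) = - sgn_alt m"
  by (simp_all add: sgn_alt_def)

text \<open>Integer exponents avoid truncated subtraction in the exponent identities. Negative
  exponents collapse to 0, whence the sign conditions in \<open>xpow_add\<close>.\<close>

definition xpow :: "int \<Rightarrow> complex fps" where
  "xpow e = fps_X ^ nat e"

lemma xpow_add: "0 \<le> a \<Longrightarrow> 0 \<le> b \<Longrightarrow> xpow (a + b) = xpow a * xpow b"
  by (simp add: xpow_def nat_add_distrib power_add)

lemma xpow_nth: "fps_nth (xpow e) n = (if n = nat e then 1 else 0)"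
  by (simp add: xpow_def)

lemma xpow_0 [simp]: "xpow 0 = 1" by (simp add: xpow_def)

text \<open>The absolute value keeps the denominator a power series; at \<open>k = 0\<close> the
  value is 1/2.\<close>

definition recip :: "int \<Rightarrow> complex fps" where
  "recip k = inverse (1 + xpow (5 * \<bar>k\<bar>))"

lemma recip_mult: "recip k * (1 + xpow (5 * \<bar>k\<bar>)) = 1"
  unfolding recip_def by (intro inverse_mult_eq_1) (simp add: xpow_nth)

text \<open>
  With \<open>P = X ^ 5\<close> this is \<open>(- 1) ^ l * X ^ ((2 * c - \<kappa>) * l) / (1 + P ^ (2 * l + \<kappa>))\<close>. When \<open>2 * l + \<kappa> < 0\<close>
  the fraction has been expanded by \<open>P ^ - (2 * l + \<kappa>)\<close>, so that only nonnegative powers occur.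
\<close>

definition lambert_term :: "int \<Rightarrow> int \<Rightarrow> int \<Rightarrow> complex fps" where
  "lambert_term c \<kappa> l = sgn_alt l * xpow ((2 * c - \<kappa>) * l + 5 * max 0 (- (2 * l + \<kappa>))) * recip (2 * l + \<kappa>)"

text \<open>The halves in the two \<open>tri\<close> exponents combine to an integral polynomial in
  \<open>m\<close>. The sign arises because \<open>tri m + tri (- m)\<close> is the square of
  \<open>m\<close>; nonnegativity is recorded for later use of \<open>xpow_add\<close>.\<close>

lemma theta_term_xpow:
  assumes "0 \<le> \<sigma>" "\<sigma> \<le> 10"
  shows "theta_term (xpow \<sigma>) (xpow (10 - \<sigma>)) m = xpow (\<sigma> * m + 5 * m * (m - 1))"
    and "theta_term (- xpow \<sigma>) (- xpow (10 - \<sigma>)) m = sgn_alt m * xpow (\<sigma> * m + 5 * m * (m - 1))"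
    and "0 \<le> \<sigma> * m + 5 * m * (m - 1)"
proof -
  have "2 * (\<sigma> * int (tri m) + (10 - \<sigma>) * int (tri (- m))) = 2 * (\<sigma> * m + 5 * m * (m - 1))"
    using two_tri[of m] two_tri[of "- m"] by algebra
  then have e: "\<sigma> * int (tri m) + (10 - \<sigma>) * int (tri (- m)) = \<sigma> * m + 5 * m * (m - 1)"
    by (simp only: mult_cancel_left) simp
  then show nn: "0 \<le> \<sigma> * m + 5 * m * (m - 1)" using assms by (simp flip: e)
  have ne: "nat \<sigma> * tri m + nat (10 - \<sigma>) * tri (- m) = nat (\<sigma> * m + 5 * m * (m - 1))"
    using assms by (simp add: nat_add_distrib nat_mult_distrib flip: e)
  then show 1: "theta_term (xpow \<sigma>) (xpow (10 - \<sigma>)) m = xpow (\<sigma> * m + 5 * m * (m - 1))"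
    unfolding theta_term_def xpow_def by (simp flip: ne add: power_add power_mult)
  have "int (tri m + tri (- m)) = m * m" using two_tri[of m] two_tri[of "- m"] by (simp add: algebra_simps)
  then have "even (int (tri m + tri (- m))) \<longleftrightarrow> even m" by simp
  then have "even (tri m + tri (- m)) \<longleftrightarrow> even m" by (simp only: even_of_nat_iff)
  then have "(- 1) ^ tri m * (- 1) ^ tri (- m) = sgn_alt m"
    by (simp add: sgn_alt_def flip: power_add)
  then show "theta_term (- xpow \<sigma>) (- xpow (10 - \<sigma>)) m = sgn_alt m * xpow (\<sigma> * m + 5 * m * (m - 1))"
    unfolding 1[symmetric] theta_term_def power_minus[of "xpow _"] by (simp add: mult_ac)
qed

text \<open>Reflecting the index turns the sum into its negative, and the coefficients have
  characteristic 0.\<close>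

lemma has_sum_antisymmetric:
  fixes f :: "int \<Rightarrow> complex fps"
  assumes f: "(f has_sum S) UNIV" and anti: "\<And>l. f (K - l) = - f l"
  shows "S = 0"
proof -
  have "((\<lambda>l. f (K - l)) has_sum S) UNIV \<longleftrightarrow> (f has_sum S) UNIV"
    by (rule has_sum_reindex_bij_witness[where i = "\<lambda>l. K - l" and j = "\<lambda>l. K - l"]) auto
  with f have "((\<lambda>l. f l + f (K - l)) has_sum S + S) UNIV" by (intro has_sum_add) auto
  then have "((\<lambda>l::int. 0 :: complex fps) has_sum S + S) UNIV" by (simp add: anti)
  then have "S + S = 0" using has_sum_0_simp has_sum_unique by blast
  then have "fps_nth S n + fps_nth S n = 0" for n by (metis fps_add_nth fps_zero_nth)
  then show ?thesis by (intro fps_ext) simp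
qed

text \<open>Linear growth of the exponents yields summability; the slack 5 absorbs the shift
  \<open>- 5 * \<kappa>\<close> for negative \<open>l\<close>.\<close>

lemma lambert_term_exponent_ge:
  fixes c \<kappa> l :: int
  assumes "c \<in> {1, 2}" "\<kappa> \<in> {0, 1}"
  shows "\<bar>l\<bar> - 5 \<le> (2 * c - \<kappa>) * l + 5 * max 0 (- (2 * l + \<kappa>))"
    "0 \<le> (2 * c - \<kappa>) * l + 5 * max 0 (- (2 * l + \<kappa>))"
  using assms by (auto simp: max_def abs_if) presburger

lemma xpow_mult_nth_eq_0: "n < nat e \<Longrightarrow> fps_nth (xpow e * F) n = 0"
  by (simp add: xpow_def fps_X_power_mult_nth)

lemma lambert_term_nth_eq_0:
  assumes "c \<in> {1, 2}" "\<kappa> \<in> {0, 1}" "int n < \<bar>l\<bar> - 5"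
  shows "fps_nth (lambert_term c \<kappa> l) n = 0"
proof -
  have "fps_nth (xpow ((2 * c - \<kappa>) * l + 5 * max 0 (- (2 * l + \<kappa>))) * (sgn_alt l * recip (2 * l + \<kappa>))) n = 0"
    using lambert_term_exponent_ge(1)[OF assms(1,2), of l] assms(3) by (intro xpow_mult_nth_eq_0) linarith
  then show ?thesis by (simp add: lambert_term_def mult_ac)
qed

lemma lambert_term_mult_nth_eq_0:
  assumes "c \<in> {1, 2}" "\<kappa> \<in> {0, 1}" "int n < \<bar>l\<bar> - 5"
  shows "fps_nth (lambert_term c \<kappa> l * F) n = 0"
  using assms by (auto simp: fps_mult_nth lambert_term_nth_eq_0 intro!: sum.neutral)

lemma lambert_term_mult_summable:
  assumes "c \<in> {1, 2}" "\<kappa> \<in> {0, 1}"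
  shows "(\<lambda>l. lambert_term c \<kappa> l * F l) summable_on UNIV"
proof (rule summable_on_fpsI, rule finite_subset)
  fix n
  show "{l \<in> UNIV. fps_nth (lambert_term c \<kappa> l * F l) n \<noteq> 0} \<subseteq> {- int n - 5..int n + 5}"
  proof
    fix l assume "l \<in> {l \<in> UNIV. fps_nth (lambert_term c \<kappa> l * F l) n \<noteq> 0}"
    then have "\<not> int n < \<bar>l\<bar> - 5" using lambert_term_mult_nth_eq_0[OF assms] by blast
    then show "l \<in> {- int n - 5..int n + 5}" by auto
  qed
qed simp

text \<open>This is \<open>T' = - X ^ (\<rho> + 10 * M) * T\<close> with negative powers cleared.
  The weights make the two exponents in summand \<open>l\<close> differ by
  \<open>5 * (2 * l + \<kappa>)\<close>, so the Lambert denominator cancels; the remaining signed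
  sum is antisymmetric under \<open>l\<close> to \<open>2 * M + 1 - l\<close>.\<close>

lemma lambert_step:
  fixes c \<kappa> M :: int
  assumes c: "c \<in> {1, 2}" and \<kappa>: "\<kappa> \<in> {0, 1}"
  defines "\<sigma> \<equiv> 2 * c - \<kappa>" and "\<rho> \<equiv> 2 * c + 4 * \<kappa>"
  assumes T: "((\<lambda>l. lambert_term c \<kappa> l * theta_term (xpow \<sigma>) (xpow (10 - \<sigma>)) (M - l)) has_sum T) UNIV"
    and T': "((\<lambda>l. lambert_term c \<kappa> l * theta_term (xpow \<sigma>) (xpow (10 - \<sigma>)) (M + 1 - l)) has_sum T') UNIV"
  shows "xpow (max 0 (- (\<rho> + 10 * M))) * T' + xpow (max 0 (\<rho> + 10 * M)) * T = 0"
proof -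
  define u v where "u = max 0 (- (\<rho> + 10 * M))" and "v = max 0 (\<rho> + 10 * M)"
  have uv: "0 \<le> u" "0 \<le> v" "v = u + \<rho> + 10 * M" by (auto simp: u_def v_def)
  define Q where "Q = (\<lambda>m. \<sigma> * m + 5 * m * (m - 1))"
  define h where "h = (\<lambda>l. \<sigma> * l + 5 * max 0 (- (2 * l + \<kappa>)))"
  define w where "w = (\<lambda>l. u + \<sigma> * (M + 1) + 5 * (M + 1 - l) * (M - l))"
  have \<sigma>: "0 \<le> \<sigma>" "\<sigma> \<le> 10" using c \<kappa> by (auto simp: \<sigma>_def)
  have Qnn: "0 \<le> Q m" for m unfolding Q_def using theta_term_xpow(3)[OF \<sigma>] .
  have hnn: "0 \<le> h l" for l unfolding h_def \<sigma>_def using lambert_term_exponent_ge(2)[OF c \<kappa>] .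
  have term_eq: "lambert_term c \<kappa> l = sgn_alt l * xpow (h l) * recip (2 * l + \<kappa>)" for l
    by (simp add: lambert_term_def h_def \<sigma>_def)
  have summand: "xpow u * (lambert_term c \<kappa> l * xpow (Q (M + 1 - l))) + xpow v * (lambert_term c \<kappa> l * xpow (Q (M - l))) = sgn_alt l * xpow (w l)"
    for l
  proof -
    define k where "k = 2 * l + \<kappa>"
    have e1: "u + h l + Q (M + 1 - l) = w l + 5 * max 0 (- k)"
      unfolding h_def Q_def w_def k_def by (simp add: algebra_simps)
    \<comment> \<open>The difference to \<open>e1\<close> is \<open>5 * k\<close> because
      \<open>\<rho> = \<sigma> + 5 * \<kappa>\<close>.\<close>
    have e2: "v + h l + Q (M - l) = w l + 5 * max 0 (- k) + 5 * k"
      unfolding h_def Q_def w_def k_def uv(3) \<rho>_def \<sigma>_def by (simp add: algebra_simps)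
    have e1nn: "0 \<le> u + h l + Q (M + 1 - l)" and e2nn: "0 \<le> v + h l + Q (M - l)"
      using uv hnn Qnn by (simp_all add: add_nonneg_nonneg)
    \<comment> \<open>According to the sign of \<open>k\<close>, the correction to
      \<open>w l\<close> vanishes in \<open>e1\<close> or in \<open>e2\<close>.\<close>
    have wnn: "0 \<le> w l" using e1 e2 e1nn e2nn by (auto simp: max_def split: if_splits)
    have "xpow u * (lambert_term c \<kappa> l * xpow (Q (M + 1 - l))) + xpow v * (lambert_term c \<kappa> l * xpow (Q (M - l)))
      = sgn_alt l * recip k * (xpow (u + h l + Q (M + 1 - l)) + xpow (v + h l + Q (M - l)))"
    proof -
      have "xpow (u + h l + Q (M + 1 - l)) = xpow u * xpow (h l) * xpow (Q (M + 1 - l))"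
        "xpow (v + h l + Q (M - l)) = xpow v * xpow (h l) * xpow (Q (M - l))"
        using uv(1,2) hnn Qnn by (simp_all only: xpow_add add_nonneg_nonneg)
      then show ?thesis unfolding term_eq k_def by (simp only: distrib_left mult_ac)
    qed
    also have "xpow (u + h l + Q (M + 1 - l)) + xpow (v + h l + Q (M - l)) = xpow (w l) * (1 + xpow (5 * \<bar>k\<bar>))"
      unfolding e1 e2 using wnn by (cases "k \<ge> 0") (auto simp: max_def xpow_add[symmetric] algebra_simps)
    also have "sgn_alt l * recip k * \<dots> = sgn_alt l * xpow (w l) * (recip k * (1 + xpow (5 * \<bar>k\<bar>)))"
      by (simp only: mult_ac)
    finally show ?thesis by (simp add: recip_mult)
  qed
  have "((\<lambda>l. xpow u * (lambert_term c \<kappa> l * xpow (Q (M + 1 - l))) + xpow v * (lambert_term c \<kappa> l * xpow (Q (M - l))))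
    has_sum xpow u * T' + xpow v * T) UNIV"
    using T T' unfolding theta_term_xpow(1)[OF \<sigma>] Q_def by (intro has_sum_add has_sum_cmult_right)
  then have "((\<lambda>l. sgn_alt l * xpow (w l)) has_sum xpow u * T' + xpow v * T) UNIV" by (simp only: summand)
  then have "xpow u * T' + xpow v * T = 0"
  proof (rule has_sum_antisymmetric[where K = "2 * M + 1"])
    fix l
    have "w (2 * M + 1 - l) = w l" by (simp add: w_def algebra_simps)
    moreover have "sgn_alt (2 * M + 1 - l) = - sgn_alt l" by (simp add: sgn_alt_def)
    ultimately show "sgn_alt (2 * M + 1 - l) * xpow (w (2 * M + 1 - l)) = - (sgn_alt l * xpow (w l))" by simp
  qed
  then show ?thesis by (simp add: u_def v_def)
qed

text \<open>The recurrence is solved in both directions from 0. Since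
  \<open>0 < \<rho> < 10\<close>, the sign of \<open>\<rho> + 10 * M\<close> is positive exactly for
  \<open>M \<ge> 0\<close>, which resolves the maxima.\<close>

lemma lambert_coeff:
  fixes c \<kappa> :: int
  assumes c: "c \<in> {1, 2}" and \<kappa>: "\<kappa> \<in> {0, 1}"
  defines "\<sigma> \<equiv> 2 * c - \<kappa>" and "\<rho> \<equiv> 2 * c + 4 * \<kappa>"
  assumes T: "\<And>M. ((\<lambda>l. lambert_term c \<kappa> l * theta_term (xpow \<sigma>) (xpow (10 - \<sigma>)) (M - l)) has_sum T M) UNIV"
  shows "T M = sgn_alt M * xpow (\<rho> * M + 5 * M * (M - 1)) * T 0"
proof -
  have \<rho>: "0 < \<rho>" "\<rho> < 10" using c \<kappa> by (auto simp: \<rho>_def)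
  have step: "xpow (max 0 (- (\<rho> + 10 * M))) * T (M + 1) + xpow (max 0 (\<rho> + 10 * M)) * T M = 0" for M
    unfolding \<rho>_def by (rule lambert_step[OF c \<kappa>]) (use T in \<open>auto simp: \<sigma>_def\<close>)
  have nn: "0 \<le> \<rho> * M + 5 * M * (M - 1)" for M using theta_term_xpow(3)[of \<rho> M] \<rho> by simp
  show ?thesis
  proof (induction M rule: int_induct[where k = 0])
    case base
    show ?case by simp
  next
    case (step1 i)
    have "max 0 (- (\<rho> + 10 * i)) = 0" "max 0 (\<rho> + 10 * i) = \<rho> + 10 * i" using step1(1) \<rho> by auto
    with step[of i] have "T (i + 1) + xpow (\<rho> + 10 * i) * T i = 0" by simp
    then have "T (i + 1) = - xpow (\<rho> + 10 * i) * T i" by (simp add: eq_neg_iff_add_eq_0)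
    moreover have "\<rho> * (i + 1) + 5 * (i + 1) * (i + 1 - 1) = (\<rho> + 10 * i) + (\<rho> * i + 5 * i * (i - 1))"
      by (simp add: algebra_simps)
    then have "xpow (\<rho> * (i + 1) + 5 * (i + 1) * (i + 1 - 1)) = xpow (\<rho> + 10 * i) * xpow (\<rho> * i + 5 * i * (i - 1))"
      using nn[of i] step1(1) \<rho> by (simp only: xpow_add)
    ultimately show ?case using step1(2) by (simp add: mult_ac)
  next
    case (step2 i)
    have eqs: "max 0 (- (\<rho> + 10 * (i - 1))) = 10 - \<rho> - 10 * i" "max 0 (\<rho> + 10 * (i - 1)) = 0" using step2(1) \<rho> by auto
    have "xpow (10 - \<rho> - 10 * i) * T i + T (i - 1) = 0" using step[of "i - 1"] unfolding eqs by simp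
    then have "T (i - 1) = - xpow (10 - \<rho> - 10 * i) * T i" by (simp add: eq_neg_iff_add_eq_0 add.commute)
    moreover have "\<rho> * (i - 1) + 5 * (i - 1) * (i - 1 - 1) = (10 - \<rho> - 10 * i) + (\<rho> * i + 5 * i * (i - 1))"
      by (simp add: algebra_simps)
    then have "xpow (\<rho> * (i - 1) + 5 * (i - 1) * (i - 1 - 1)) = xpow (10 - \<rho> - 10 * i) * xpow (\<rho> * i + 5 * i * (i - 1))"
      using nn[of i] step2(1) \<rho> by (simp only: xpow_add)
    ultimately show ?case using step2(2) by (simp add: mult_ac)
  qed
qed

text \<open>Grouping the double series for \<open>L * F\<close> by \<open>M = l + m\<close> gives
  the sums of \<open>lambert_coeff\<close>, each equal to \<open>D\<close> times a term of
  \<open>G\<close>. By \<open>lambert_constant\<close> below, \<open>D\<close> is a series in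
  \<open>P\<close>.\<close>

lemma lambert_theta_quotient:
  fixes c \<kappa> :: int
  assumes c: "c \<in> {1, 2}" and \<kappa>: "\<kappa> \<in> {0, 1}"
  defines "\<sigma> \<equiv> 2 * c - \<kappa>" and "\<rho> \<equiv> 2 * c + 4 * \<kappa>"
  assumes L: "(lambert_term c \<kappa> has_sum L) UNIV"
    and F: "(theta_term (xpow \<sigma>) (xpow (10 - \<sigma>)) has_sum F) UNIV"
    and G: "(theta_term (- xpow \<rho>) (- xpow (10 - \<rho>)) has_sum G) UNIV"
    and D: "((\<lambda>l. lambert_term c \<kappa> l * theta_term (xpow \<sigma>) (xpow (10 - \<sigma>)) (- l)) has_sum D) UNIV"
  shows "L * F = D * G"
proof -
  define t where "t = theta_term (xpow \<sigma>) (xpow (10 - \<sigma>))"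
  define T where "T = (\<lambda>M. infsum (\<lambda>l. lambert_term c \<kappa> l * t (M - l)) UNIV)"
  have T: "((\<lambda>l. lambert_term c \<kappa> l * t (M - l)) has_sum T M) UNIV" for M
    unfolding T_def using lambert_term_mult_summable[OF c \<kappa>] by (rule has_sum_infsum)
  have "T 0 = D" using has_sum_unique[OF T[of 0]] D by (simp add: t_def)
  have TM: "T M = sgn_alt M * xpow (\<rho> * M + 5 * M * (M - 1)) * D" for M
    unfolding \<open>T 0 = D\<close>[symmetric] \<rho>_def using T unfolding t_def \<sigma>_def by (rule lambert_coeff[OF c \<kappa>])
  have "((\<lambda>(l, m). lambert_term c \<kappa> l * t m) has_sum L * F) (UNIV \<times> UNIV)"
    unfolding t_def by (rule has_sum_fps_mult[OF L F])
  also have "?this \<longleftrightarrow> ((\<lambda>(M, l). lambert_term c \<kappa> l * t (M - l)) has_sum L * F) (UNIV \<times> UNIV)"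
    by (rule has_sum_reindex_bij_witness[where j = "\<lambda>(l, m). (l + m, l)" and i = "\<lambda>(M, l). (l, M - l)"]) auto
  finally have "(T has_sum L * F) UNIV"
    by (rule has_sum_SigmaD) (use T in auto)
  moreover have "0 \<le> \<rho>" "\<rho> \<le> 10" using c \<kappa> by (auto simp: \<rho>_def)
  then have "T M = D * theta_term (- xpow \<rho>) (- xpow (10 - \<rho>)) M" for M
    using theta_term_xpow(2)[of \<rho> M] by (simp add: TM mult_ac)
  then have "(T has_sum D * G) UNIV" using has_sum_cmult_right[OF G, of D] by presburger
  ultimately show ?thesis using has_sum_unique by blast
qed

section \<open>Vanishing coefficients of the Lambert series\<close>

lemma recip_nth:
  assumes "k \<noteq> 0"
  shows "fps_nth (recip k) j = (if 5 * \<bar>k\<bar> dvd int j then (- 1) ^ (j div nat (5 * \<bar>k\<bar>)) else 0)"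
proof -
  define d where "d = nat (5 * \<bar>k\<bar>)"
  have d: "d > 0" using assms by (simp add: d_def)
  define G :: "complex fps" where "G = Abs_fps (\<lambda>j. if d dvd j then (- 1) ^ (j div d) else 0)"
  have "G * (1 + fps_X ^ d) = 1"
  proof (rule fps_ext)
    fix n
    have "fps_nth (G * (1 + fps_X ^ d)) n = fps_nth G n + (if n < d then 0 else fps_nth G (n - d))"
      by (simp add: distrib_left fps_X_power_mult_right_nth)
    also have "\<dots> = fps_nth 1 n"
    proof (cases "n < d")
      case True
      then show ?thesis by (auto simp: G_def dest: dvd_imp_le)
    next
      case False
      then obtain m where m: "n = d + m" using le_Suc_ex[of d n] by auto
      then show ?thesis using d by (simp add: G_def)
    qed
    finally show "fps_nth (G * (1 + fps_X ^ d)) n = fps_nth 1 n" .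
  qed
  moreover have "recip k * (1 + fps_X ^ d) = 1" using recip_mult[of k] by (simp add: xpow_def d_def)
  ultimately have "recip k = G" by (metis mult.assoc mult.commute mult.right_neutral)
  moreover have "5 * \<bar>k\<bar> dvd int j \<longleftrightarrow> d dvd j"
    unfolding d_def by (metis abs_ge_zero int_dvd_int_iff mult_nonneg_nonneg nat_0_le zero_le_numeral)
  ultimately show ?thesis by (simp add: G_def d_def)
qed

text \<open>
  The pairs that index the contributions \<open>\<plusminus>1\<close> to the coefficient of \<open>X ^ n\<close> once each fraction is expanded as a
  geometric series. The case \<open>m < 0\<close> comes from reflecting the index of that series when \<open>2 * l + \<kappa> < 0\<close>, which
  makes the exponent the same polynomial in \<open>(l, m)\<close> in both cases, at the price of a sign.
\<close>

definition lambert_index :: "int \<Rightarrow> int \<Rightarrow> nat \<Rightarrow> (int \<times> int) set" where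
  "lambert_index c \<kappa> n = {(l, m). int n = (2 * c - \<kappa>) * l + 5 * m * (2 * l + \<kappa>) \<and>
     (2 * l + \<kappa> > 0 \<and> m \<ge> 0 \<or> 2 * l + \<kappa> < 0 \<and> m < 0)}"

text \<open>The geometric series meets the required degree in a single term, of index
  \<open>m'\<close>. For \<open>2 * l + \<kappa> < 0\<close> the reflection
  \<open>m' = - m - 1\<close> changes the parity, which is the extra sign.\<close>

lemma lambert_term_nth_index:
  assumes "c \<in> {1, 2}" "\<kappa> \<in> {0, 1}" "(l, m) \<in> lambert_index c \<kappa> n"
  shows "fps_nth (lambert_term c \<kappa> l) n = (if 2 * l + \<kappa> > 0 then 1 else - 1) * (if even (l + m) then 1 else - 1)"
proof -
  define k h where "k = 2 * l + \<kappa>" and "h = (2 * c - \<kappa>) * l + 5 * max 0 (- (2 * l + \<kappa>))"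
  define m' where "m' = (if k > 0 then m else - m - 1)"
  have k: "k \<noteq> 0" "0 \<le> m'" using assms(3) by (auto simp: lambert_index_def k_def m'_def)
  have h: "0 \<le> h" unfolding h_def by (rule lambert_term_exponent_ge(2)[OF assms(1,2)])
  have n: "int n = h + m' * (5 * \<bar>k\<bar>)"
    using assms(3) by (auto simp: lambert_index_def k_def m'_def h_def algebra_simps)
  moreover have "0 \<le> m' * (5 * \<bar>k\<bar>)" using k by simp
  ultimately have "nat h \<le> n" by linarith
  moreover have diff: "int (n - nat h) = m' * (5 * \<bar>k\<bar>)" using n h \<open>nat h \<le> n\<close> by (simp add: of_nat_diff)
  have "(n - nat h) div nat (5 * \<bar>k\<bar>) = nat m'"
  proof -
    have "int (n - nat h) = int (nat m' * nat (5 * \<bar>k\<bar>))" using diff k by simp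
    then have "n - nat h = nat m' * nat (5 * \<bar>k\<bar>)" by (simp only: of_nat_eq_iff)
    then show ?thesis using k by simp
  qed
  moreover have "5 * \<bar>k\<bar> dvd int (n - nat h)" unfolding diff by simp
  ultimately have "fps_nth (recip k) (n - nat h) = (- 1) ^ nat m'" using k by (simp add: recip_nth)
  moreover have "(- 1 :: complex) ^ nat m' = (if even m' then 1 else - 1)" using k by (simp add: even_nat_iff)
  moreover have "even m' \<longleftrightarrow> (if k > 0 then even m else odd m)" by (simp add: m'_def)
  moreover have "fps_nth (lambert_term c \<kappa> l) n = fps_nth (sgn_alt l) 0 * fps_nth (recip k) (n - nat h)"
    using \<open>nat h \<le> n\<close> by (simp add: lambert_term_def k_def h_def sgn_alt_def xpow_def fps_X_power_mult_nth)
  ultimately show ?thesis by (auto simp: sgn_alt_def k_def)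
qed

lemma lambert_term_nth_nonzero:
  assumes "c \<in> {1, 2}" "\<kappa> \<in> {0, 1}" "n > 0" "fps_nth (lambert_term c \<kappa> l) n \<noteq> 0"
  shows "\<exists>m. (l, m) \<in> lambert_index c \<kappa> n"
proof -
  define k h where "k = 2 * l + \<kappa>" and "h = (2 * c - \<kappa>) * l + 5 * max 0 (- (2 * l + \<kappa>))"
  have h: "0 \<le> h" unfolding h_def by (rule lambert_term_exponent_ge(2)[OF assms(1,2)])
  have eq: "fps_nth (lambert_term c \<kappa> l) n = (if n < nat h then 0 else fps_nth (sgn_alt l) 0 * fps_nth (recip k) (n - nat h))"
    by (simp add: lambert_term_def k_def h_def sgn_alt_def xpow_def fps_X_power_mult_nth)
  then have "nat h \<le> n" and nz: "fps_nth (recip k) (n - nat h) \<noteq> 0" using assms(4) by (auto split: if_splits)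
  \<comment> \<open>\<open>k = 0\<close> forces \<open>l = 0\<close> and a constant term 1/2, which
    is excluded by \<open>n > 0\<close>.\<close>
  have "k \<noteq> 0"
  proof
    assume "k = 0"
    then have "l = 0" "h = 0" using assms(2) by (auto simp: k_def h_def)
    moreover have "recip 0 = fps_const (1 / 2)"
    proof -
      have "recip 0 = inverse (fps_const 2)" by (simp add: recip_def numeral_fps_const)
      then show ?thesis by (simp add: fps_const_inverse field_simps)
    qed
    ultimately show False using nz \<open>k = 0\<close> assms(3) by simp
  qed
  with nz have "5 * \<bar>k\<bar> dvd int (n - nat h)" by (auto simp: recip_nth split: if_splits)
  then obtain j where j: "int (n - nat h) = 5 * \<bar>k\<bar> * j" by blast
  then have "0 \<le> 5 * \<bar>k\<bar> * j" by (metis of_nat_0_le_iff)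
  then have "0 \<le> j" using \<open>k \<noteq> 0\<close> by (simp add: zero_le_mult_iff)
  have n: "int n = h + 5 * \<bar>k\<bar> * j" using j \<open>nat h \<le> n\<close> h by (simp add: of_nat_diff)
  have "(l, if k > 0 then j else - j - 1) \<in> lambert_index c \<kappa> n"
    using n \<open>0 \<le> j\<close> \<open>k \<noteq> 0\<close> by (auto simp: lambert_index_def h_def k_def algebra_simps)
  then show ?thesis ..
qed

lemma lambert_series_vanish:
  fixes c \<kappa> :: int
  assumes c: "c \<in> {1, 2}" and \<kappa>: "\<kappa> \<in> {0, 1}" and L: "(lambert_term c \<kappa> has_sum L) UNIV"
    and n: "n > 0" "int n mod 5 = (- c * (2 * c - \<kappa>)) mod 5"
  shows "fps_nth L n = 0"
proof -
  define I where "I = lambert_index c \<kappa> n"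
  define val :: "int \<times> int \<Rightarrow> complex" where
    "val = (\<lambda>(l, m). (if 2 * l + \<kappa> > 0 then 1 else - 1) * (if even (l + m) then 1 else - 1))"
  \<comment> \<open>Up to an additive constant, \<open>2 * n\<close> is the product of \<open>2 * l + \<kappa>\<close> and \<open>10 * m + 2 * c - \<kappa>\<close>; swapping the two factors
    and negating both is a sign-reversing involution, well defined in the residue class considered.\<close>
  define \<phi> where "\<phi> = (\<lambda>(l, m). (- 5 * m - c, (- l - c) div 5))"
  \<comment> \<open>For each \<open>l\<close> there is at most one \<open>m\<close>, so a sum over
    \<open>l\<close> can be replaced by a sum over pairs.\<close>
  have uniq: "m = m'" if "(l, m) \<in> I" "(l, m') \<in> I" for l m m'
  proof -
    have "5 * (m * (2 * l + \<kappa>)) = 5 * (m' * (2 * l + \<kappa>))" "2 * l + \<kappa> \<noteq> 0"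
      using that unfolding I_def lambert_index_def by auto
    then show ?thesis by simp
  qed
  \<comment> \<open>\<open>2 * c - \<kappa>\<close> is invertible modulo 5, so the residue of
    \<open>n\<close> forces \<open>l\<close> to be congruent to \<open>- c\<close>; this makes the
    division in \<open>\<phi>\<close> exact.\<close>
  have dvd: "5 dvd l + c" if "(l, m) \<in> I" for l m
  proof -
    have e: "int n = (2 * c - \<kappa>) * l + 5 * (m * (2 * l + \<kappa>))" using that by (simp add: I_def lambert_index_def)
    have "int n mod 5 = ((2 * c - \<kappa>) * l) mod 5" unfolding e by simp
    with n(2) have "((2 * c - \<kappa>) * l) mod 5 = (- c * (2 * c - \<kappa>)) mod 5" by simp
    then show ?thesis using c \<kappa> by (auto; presburger)
  qed
  have \<phi>: "\<phi> p \<in> I \<and> \<phi> (\<phi> p) = p \<and> val (\<phi> p) = - val p" if pI: "p \<in> I" for p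
  proof -
    obtain l m where p: "p = (l, m)" by (cases p)
    obtain j where j: "l + c = 5 * j" using dvd pI unfolding p dvd_def by blast
    then have l: "l = 5 * j - c" by simp
    then have "- l - c = 5 * (- j)" by simp
    then have \<phi>p: "\<phi> p = (- 5 * m - c, - j)" by (simp add: \<phi>_def p)
    have 1: "\<phi> (\<phi> p) = p" unfolding \<phi>p by (simp add: \<phi>_def p l)
    have e: "int n = (2 * c - \<kappa>) * l + 5 * m * (2 * l + \<kappa>)"
      and v: "2 * l + \<kappa> > 0 \<and> m \<ge> 0 \<or> 2 * l + \<kappa> < 0 \<and> m < 0"
      using pI by (auto simp: p I_def lambert_index_def)
    have e': "int n = (2 * c - \<kappa>) * (- 5 * m - c) + 5 * (- j) * (2 * (- 5 * m - c) + \<kappa>)"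
      unfolding e l by (simp add: algebra_simps)
    \<comment> \<open>Here \<open>2 * l + \<kappa> = 10 * j - (2 * c - \<kappa>)\<close> with
      \<open>0 < 2 * c - \<kappa> < 10\<close>, so its sign is read off from \<open>j\<close>; the
      other factor is read off from \<open>m\<close> in the same way.\<close>
    have v': "2 * l + \<kappa> > 0 \<and> 2 * (- 5 * m - c) + \<kappa> < 0 \<and> - j < 0 \<or> 2 * l + \<kappa> < 0 \<and> 2 * (- 5 * m - c) + \<kappa> > 0 \<and> - j \<ge> 0"
    proof -
      have a: "1 \<le> 2 * c - \<kappa>" "2 * c - \<kappa> \<le> 4" using c \<kappa> by auto
      show ?thesis using v
      proof
        assume "2 * l + \<kappa> > 0 \<and> m \<ge> 0"
        moreover from this have "j > 0" using a l by presburger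
        ultimately show ?thesis using a by simp
      next
        assume "2 * l + \<kappa> < 0 \<and> m < 0"
        moreover from this have "j \<le> 0" using a l by presburger
        ultimately show ?thesis using a by simp
      qed
    qed
    have 2: "\<phi> p \<in> I" unfolding \<phi>p I_def lambert_index_def using e' v' by auto
    \<comment> \<open>The parity sign is preserved, while the sign coming from
      \<open>2 * l + \<kappa>\<close> is reversed.\<close>
    have "even (- 5 * m - c + - j) \<longleftrightarrow> even (l + m)" unfolding l by auto
    then have 3: "val (\<phi> p) = - val p" using v' unfolding \<phi>p by (auto simp: val_def p)
    from 1 2 3 show ?thesis by simp
  qed
  define N where "N = {l \<in> UNIV. fps_nth (lambert_term c \<kappa> l) n \<noteq> 0}"
  have fin: "finite N" unfolding N_def by (rule has_sum_fps_nth(1)[OF L])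
  have N: "N = fst ` I"
  proof
    show "N \<subseteq> fst ` I" unfolding N_def I_def using lambert_term_nth_nonzero[OF c \<kappa> n(1)] by force
    show "fst ` I \<subseteq> N" unfolding N_def I_def using lambert_term_nth_index[OF c \<kappa>] by force
  qed
  have inj: "inj_on fst I" using uniq by (auto intro!: inj_onI)
  have "fps_nth L n = (\<Sum>l\<in>N. fps_nth (lambert_term c \<kappa> l) n)" unfolding N_def by (rule has_sum_fps_nth(2)[OF L])
  also have "\<dots> = (\<Sum>p\<in>I. val p)"
    unfolding N sum.reindex[OF inj] by (intro sum.cong refl) (auto simp: lambert_term_nth_index[OF c \<kappa>] val_def I_def)
  finally have 1: "fps_nth L n = (\<Sum>p\<in>I. val p)" .
  have "(\<Sum>p\<in>I. val p) = (\<Sum>p\<in>I. - val p)"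
    by (rule sum.reindex_bij_witness[of _ \<phi> \<phi>]) (use \<phi> in auto)
  then show ?thesis unfolding 1 by (simp add: sum_negf)
qed

section \<open>Series in the fifth power of the variable\<close>

definition series_in_X5 :: "complex fps \<Rightarrow> bool" where
  "series_in_X5 F \<longleftrightarrow> (\<forall>n. \<not> 5 dvd n \<longrightarrow> fps_nth F n = 0)"

definition vanish_4_mod_5 :: "complex fps \<Rightarrow> bool" where
  "vanish_4_mod_5 F \<longleftrightarrow> (\<forall>n. fps_nth F (5 * n + 4) = 0)"

lemma series_in_X5_mult:
  assumes "series_in_X5 F" "series_in_X5 G"
  shows "series_in_X5 (F * G)"
  unfolding series_in_X5_def
proof (intro allI impI)
  fix n :: nat assume n: "\<not> 5 dvd n"
  have "fps_nth F i * fps_nth G (n - i) = 0" if "i \<le> n" for i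
  proof -
    have "\<not> 5 dvd i \<or> \<not> 5 dvd (n - i)" using n that by (metis dvd_add le_add_diff_inverse)
    then show ?thesis using assms by (auto simp: series_in_X5_def)
  qed
  then show "fps_nth (F * G) n = 0" unfolding fps_mult_nth by (intro sum.neutral) auto
qed

lemma series_in_X5_has_sum:
  assumes "(f has_sum S) I" "\<And>i. i \<in> I \<Longrightarrow> series_in_X5 (f i)"
  shows "series_in_X5 S"
  using assms(2) unfolding series_in_X5_def has_sum_fps_nth(2)[OF assms(1)] by (auto intro!: sum.neutral)

lemma series_in_X5_power: "5 dvd n \<Longrightarrow> series_in_X5 (fps_X ^ n)"
  by (auto simp: series_in_X5_def)

lemma series_in_X5_qpoch_inf:
  assumes "5 dvd k" "k > 0"
  shows "series_in_X5 (qpoch_inf (fps_X ^ k) (fps_X ^ k))"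
  unfolding series_in_X5_def
proof (intro allI impI)
  fix n :: nat assume n: "\<not> 5 dvd n"
  have "series_in_X5 (\<Prod>j<m. 1 - fps_X ^ k * (fps_X ^ k) ^ j)" for m
  proof (induction m)
    case 0
    show ?case by (auto simp: series_in_X5_def)
  next
    case (Suc m)
    have "series_in_X5 (fps_X ^ k * (fps_X ^ k) ^ m)"
      using assms by (simp add: series_in_X5_power flip: power_add power_mult)
    then have "series_in_X5 (1 - fps_X ^ k * (fps_X ^ k) ^ m)" by (auto simp: series_in_X5_def)
    with Suc show ?case by (simp add: series_in_X5_mult)
  qed
  then have zero: "fps_nth (\<Prod>j<m. 1 - fps_X ^ k * (fps_X ^ k) ^ j) n = (0 :: complex)" for m
    using n by (simp add: series_in_X5_def)
  have "(\<lambda>m. \<Prod>j<m. 1 - fps_X ^ k * (fps_X ^ k) ^ j) \<longlonglongrightarrow> qpoch_inf (fps_X ^ k) (fps_X ^ k :: complex fps)"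
    using assms(2) by (intro qpoch_inf_tendsto) auto
  then have "\<forall>\<^sub>F m::nat in sequentially. fps_nth (\<Prod>j<m. 1 - fps_X ^ k * (fps_X ^ k) ^ j) n
      = fps_nth (qpoch_inf (fps_X ^ k) (fps_X ^ k :: complex fps)) n"
    unfolding tendsto_fps_iff by blast
  then show "fps_nth (qpoch_inf (fps_X ^ k) (fps_X ^ k :: complex fps)) n = 0"
    unfolding zero by simp
qed

text \<open>Since \<open>H\<close> contributes only degrees divisible by 5, the matching degree in
  \<open>F\<close> is again 4 modulo 5.\<close>

lemma vanish_4_mod_5_mult:
  assumes "vanish_4_mod_5 F" "series_in_X5 H"
  shows "vanish_4_mod_5 (F * H)"
  unfolding vanish_4_mod_5_def
proof
  fix n
  have "fps_nth F i * fps_nth H (5 * n + 4 - i) = 0" if "i \<le> 5 * n + 4" for i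
  proof (cases "5 dvd (5 * n + 4 - i)")
    case True
    then have "i = 5 * (i div 5) + 4" using that by presburger
    then have "fps_nth F i = 0" using assms(1) by (metis vanish_4_mod_5_def)
    then show ?thesis by simp
  qed (use assms(2) in \<open>auto simp: series_in_X5_def\<close>)
  then show "fps_nth (F * H) (5 * n + 4) = 0" unfolding fps_mult_nth by (intro sum.neutral) auto
qed

text \<open>By strong induction every term of the product coefficient vanishes except the one with
  the constant coefficient of \<open>H\<close>.\<close>

lemma vanish_4_mod_5_cancel:
  assumes "vanish_4_mod_5 (F * H)" "series_in_X5 H" "fps_nth H 0 \<noteq> 0"
  shows "vanish_4_mod_5 F"
proof -
  have "fps_nth F (5 * n + 4) = 0" for n
  proof (induction n rule: less_induct)
    case (less n)
    have zero: "fps_nth F i * fps_nth H (5 * n + 4 - i) = 0" if "i < 5 * n + 4" for i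
    proof (cases "5 dvd (5 * n + 4 - i)")
      case True
      then have "i mod 5 = 4" using that by presburger
      then have "i = 5 * (i div 5) + 4" by presburger
      moreover from this have "i div 5 < n" using that by linarith
      ultimately have "fps_nth F i = 0" using less by metis
      then show ?thesis by simp
    qed (use assms(2) in \<open>auto simp: series_in_X5_def\<close>)
    have "fps_nth (F * H) (5 * n + 4) = (\<Sum>i=0..5*n+4. fps_nth F i * fps_nth H (5 * n + 4 - i))"
      by (simp add: fps_mult_nth)
    also have "\<dots> = (\<Sum>i\<in>{5*n+4}. fps_nth F i * fps_nth H (5 * n + 4 - i))"
      using zero by (intro sum.mono_neutral_right) auto
    finally show ?case using assms(1,3) by (simp add: vanish_4_mod_5_def)
  qed
  then show ?thesis by (simp add: vanish_4_mod_5_def)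
qed

lemma recip_nth_0: "fps_nth (recip k) 0 \<noteq> 0"
proof -
  have "fps_nth (recip k * (1 + xpow (5 * \<bar>k\<bar>))) 0 = 1" by (simp only: recip_mult) simp
  then show ?thesis by auto
qed

lemma series_in_X5_recip: "series_in_X5 (recip k)"
proof (cases "k = 0")
  case True
  have "recip 0 = inverse (fps_const 2)" by (simp add: recip_def numeral_fps_const)
  then have "recip 0 = fps_const (inverse 2)" by (simp add: fps_const_inverse)
  then show ?thesis using True by (auto simp: series_in_X5_def)
next
  case False
  have "5 dvd n" if "5 * \<bar>k\<bar> dvd int n" for n
  proof -
    have "(5::int) dvd int n" using that by (rule dvd_mult_left)
    then show ?thesis by presburger
  qed
  then show ?thesis using False by (auto simp: series_in_X5_def recip_nth)
qed

text \<open>The linear exponents of the Lambert term at \<open>l\<close> and the theta term at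
  \<open>- l\<close> cancel and leave \<open>5 * e l\<close>. Only \<open>l = 0\<close> reaches
  degree 0; the nonzero constant coefficient allows division by \<open>D\<close> later.\<close>

lemma lambert_constant:
  fixes c \<kappa> :: int
  assumes c: "c \<in> {1, 2}" and \<kappa>: "\<kappa> \<in> {0, 1}"
    and D: "((\<lambda>l. lambert_term c \<kappa> l * theta_term (xpow (2 * c - \<kappa>)) (xpow (10 - (2 * c - \<kappa>))) (- l)) has_sum D) UNIV"
  shows "series_in_X5 D" "fps_nth D 0 \<noteq> 0"
proof -
  define f where "f = (\<lambda>l. lambert_term c \<kappa> l * theta_term (xpow (2 * c - \<kappa>)) (xpow (10 - (2 * c - \<kappa>))) (- l))"
  define e where "e = (\<lambda>l. max 0 (- (2 * l + \<kappa>)) + l * (l + 1))"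
  have ll: "0 \<le> l * (l + 1)" for l :: int using two_tri[of l] by linarith
  have f: "f l = xpow (5 * e l) * (sgn_alt l * recip (2 * l + \<kappa>))" for l
  proof -
    have \<sigma>: "0 \<le> 2 * c - \<kappa>" "2 * c - \<kappa> \<le> 10" using c \<kappa> by auto
    have "5 * e l = ((2 * c - \<kappa>) * l + 5 * max 0 (- (2 * l + \<kappa>))) + ((2 * c - \<kappa>) * (- l) + 5 * (- l) * (- l - 1))"
      by (simp add: e_def algebra_simps)
    then have "xpow (5 * e l) = xpow ((2 * c - \<kappa>) * l + 5 * max 0 (- (2 * l + \<kappa>))) * xpow ((2 * c - \<kappa>) * (- l) + 5 * (- l) * (- l - 1))"
      using lambert_term_exponent_ge(2)[OF c \<kappa>, of l] theta_term_xpow(3)[OF \<sigma>, of "- l"] by (simp only: xpow_add)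
    then show ?thesis unfolding f_def lambert_term_def theta_term_xpow(1)[OF \<sigma>] by (simp only: mult_ac)
  qed
  show "series_in_X5 D"
  proof (rule series_in_X5_has_sum[OF D])
    fix l
    have "nat (5 * e l) = 5 * nat (e l)" by (simp add: nat_mult_distrib)
    then have "series_in_X5 (xpow (5 * e l))" by (simp add: xpow_def series_in_X5_power)
    moreover have "series_in_X5 (sgn_alt l * recip (2 * l + \<kappa>))"
      using series_in_X5_recip[of "2 * l + \<kappa>"] by (simp add: sgn_alt_def series_in_X5_def)
    ultimately show "series_in_X5 (lambert_term c \<kappa> l * theta_term (xpow (2 * c - \<kappa>)) (xpow (10 - (2 * c - \<kappa>))) (- l))"
      unfolding f[unfolded f_def] by (rule series_in_X5_mult)
  qed
  have "fps_nth (f l) 0 = 0" if "l \<noteq> 0" for l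
  proof -
    have "0 < e l"
    \<comment> \<open>The quadratic part of \<open>e\<close> vanishes at \<open>l = - 1\<close>,
      where the maximum is positive instead.\<close>
    proof (cases "l = - 1")
      case True
      then show ?thesis using \<kappa> by (auto simp: e_def)
    next
      case False
      with that have "0 < l * (l + 1)" by (auto simp: zero_less_mult_iff)
      then show ?thesis by (simp add: e_def)
    qed
    then show ?thesis unfolding f by (intro xpow_mult_nth_eq_0) simp
  qed
  moreover have f0: "fps_nth (f 0) 0 \<noteq> 0" unfolding f using \<kappa> recip_nth_0 by (auto simp: e_def)
  ultimately have "{l \<in> UNIV. fps_nth (f l) 0 \<noteq> 0} = {0}" by auto
  then have "fps_nth D 0 = fps_nth (f 0) 0" using has_sum_fps_nth(2)[OF D[folded f_def], of 0] by simp
  with f0 show "fps_nth D 0 \<noteq> 0" by simp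
qed

section \<open>The quotients of theta functions\<close>

text \<open>The slack 1 accommodates the exponent \<open>l * (l + 1)\<close>, which is 0 at
  \<open>l = - 1\<close>.\<close>

lemma X5_power_summable:
  assumes "\<And>l::int. \<bar>l\<bar> \<le> int (g l) + 1"
  shows "(\<lambda>l. (fps_X ^ 5 :: complex fps) ^ g l) summable_on UNIV"
proof (rule summable_on_fpsI, rule finite_subset)
  fix n
  show "{l \<in> UNIV. fps_nth ((fps_X ^ 5 :: complex fps) ^ g l) n \<noteq> 0} \<subseteq> {- int n - 1..int n + 1}"
  proof
    fix l assume "l \<in> {l \<in> UNIV. fps_nth ((fps_X ^ 5 :: complex fps) ^ g l) n \<noteq> 0}"
    then have "5 * g l = n" by (auto simp flip: power_mult split: if_splits)
    with assms[of l] show "l \<in> {- int n - 1..int n + 1}" by auto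
  qed
qed simp

text \<open>Common form of both series. One factor of the cube pairs with the last theta product to
  give \<open>N\<close>; the remaining square is dissected by \<open>theta_square\<close>.\<close>

lemma theta_cube_quotient_vanish:
  fixes S q :: "complex fps" and r :: nat
  assumes r: "r = 1 \<or> r = 2" and q: "q = fps_X"
    and S: "S * (qpoch_inf (- (q ^ (2 * r))) (q ^ 5) * qpoch_inf (- (q ^ (5 - 2 * r))) (q ^ 5)) =
      (qpoch_inf (- (q ^ r)) (q ^ 5) * qpoch_inf (- (q ^ (5 - r))) (q ^ 5)) ^ 3 *
      (qpoch_inf (q ^ r) (q ^ 5) * qpoch_inf (q ^ (5 - r)) (q ^ 5))"
  shows "vanish_4_mod_5 S"
proof -
  define m1 where "m1 = qpoch_inf (- (q ^ r)) (q ^ 5) * qpoch_inf (- (q ^ (5 - r))) (q ^ 5)"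
  define n1 where "n1 = qpoch_inf (q ^ r) (q ^ 5) * qpoch_inf (q ^ (5 - r)) (q ^ 5)"
  define m2 where "m2 = qpoch_inf (- (q ^ (2 * r))) (q ^ 5) * qpoch_inf (- (q ^ (5 - 2 * r))) (q ^ 5)"
  define K1 where "K1 = qpoch_inf (- (q ^ (2 * r))) (q ^ 10) * qpoch_inf (- (q ^ (10 - 2 * r))) (q ^ 10)"
  define K2 where "K2 = qpoch_inf (- (q ^ (5 - 2 * r))) (q ^ 10) * qpoch_inf (- (q ^ (5 + 2 * r))) (q ^ 10)"
  define N where "N = qpoch_inf (q ^ (2 * r)) (q ^ 10) * qpoch_inf (q ^ (10 - 2 * r)) (q ^ 10)"
  define E5 where "E5 = qpoch_inf (q ^ 5) (q ^ 5)"
  define E10 where "E10 = qpoch_inf (q ^ 10) (q ^ 10)"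
  have r': "0 < r" "2 * r < 5" using r by auto
  have qn [simp]: "q \<noteq> 0" "fps_nth (q ^ k) 0 = (if k = 0 then 1 else 0)" for k by (simp_all add: q)

  have m1n1: "m1 * n1 = N"
  proof -
    have e1: "qpoch_inf (q ^ r) (q ^ 5) * qpoch_inf (- (q ^ r)) (q ^ 5) = qpoch_inf (q ^ (2 * r)) (q ^ 10)"
      using qpoch_inf_mult_neg[of "q ^ r" "q ^ 5"] r' by (simp add: mult.commute flip: power_mult)
    have e2: "qpoch_inf (q ^ (5 - r)) (q ^ 5) * qpoch_inf (- (q ^ (5 - r))) (q ^ 5) = qpoch_inf (q ^ (10 - 2 * r)) (q ^ 10)"
      using qpoch_inf_mult_neg[of "q ^ (5 - r)" "q ^ 5"] r' by (simp add: diff_mult_distrib mult.commute[of r] flip: power_mult)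
    show ?thesis unfolding m1_def n1_def N_def e1[symmetric] e2[symmetric] by (simp only: mult_ac)
  qed
  \<comment> \<open>Passing to base \<open>q ^ 10\<close> shows that the denominator is made of the
    two theta products in the dissection.\<close>
  have m2: "m2 = K1 * K2"
  proof -
    have "2 * r + 5 = 5 + 2 * r" "5 - 2 * r + 5 = 10 - 2 * r" using r' by auto
    then have "qpoch_inf (- (q ^ (2 * r))) (q ^ 5) = qpoch_inf (- (q ^ (2 * r))) (q ^ 10) * qpoch_inf (- (q ^ (5 + 2 * r))) (q ^ 10)"
      "qpoch_inf (- (q ^ (5 - 2 * r))) (q ^ 5) = qpoch_inf (- (q ^ (5 - 2 * r))) (q ^ 10) * qpoch_inf (- (q ^ (10 - 2 * r))) (q ^ 10)"
      using qpoch_inf_split[of "- (q ^ (2 * r))" "q ^ 5"] qpoch_inf_split[of "- (q ^ (5 - 2 * r))" "q ^ 5"] r'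
      by (simp_all add: add.commute[of 5 "2 * r"] flip: power_add power_mult)
    then show ?thesis unfolding m2_def K1_def K2_def by (simp add: mult_ac)
  qed
  have K0: "fps_nth (K1 * K2) 0 = 1"
    unfolding K1_def K2_def using r' by (simp add: fps_mult_nth qpoch_inf_nth_0)
  have E5: "series_in_X5 E5" "fps_nth E5 0 = 1"
    unfolding E5_def using series_in_X5_qpoch_inf[of 5] by (simp_all add: qpoch_inf_nth_0 q)
  have E10: "series_in_X5 E10"
    unfolding E10_def using series_in_X5_qpoch_inf[of 10] by (simp add: q)

  have F1: "(theta_term (q ^ (2 * r)) (q ^ (10 - 2 * r)) has_sum K1 * E10) UNIV"
    unfolding K1_def E10_def using jacobi_triple_product[of "q ^ (2 * r)" "q ^ (10 - 2 * r)"] r' by (simp flip: power_add)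
  have F2: "(theta_term (q ^ (5 - 2 * r)) (q ^ (5 + 2 * r)) has_sum K2 * E10) UNIV"
    unfolding K2_def E10_def using jacobi_triple_product[of "q ^ (5 - 2 * r)" "q ^ (5 + 2 * r)"] r' by (simp flip: power_add)
  have N1: "(theta_term (- (q ^ (2 * r))) (- (q ^ (10 - 2 * r))) has_sum N * E10) UNIV"
    unfolding N_def E10_def using jacobi_triple_product[of "- (q ^ (2 * r))" "- (q ^ (10 - 2 * r))"] r' by (simp flip: power_add)
  have N2: "(theta_term (- (q ^ (10 - 2 * r))) (- (q ^ (2 * r))) has_sum N * E10) UNIV"
    unfolding N_def E10_def using jacobi_triple_product[of "- (q ^ (10 - 2 * r))" "- (q ^ (2 * r))"] r'
    by (simp add: mult_ac flip: power_add)
  have F0: "(theta_term (q ^ r) (q ^ (5 - r)) has_sum m1 * E5) UNIV"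
    unfolding m1_def E5_def using jacobi_triple_product[of "q ^ r" "q ^ (5 - r)"] r' by (simp flip: power_add)

  obtain A where A: "((\<lambda>l. (q ^ 5) ^ nat (l ^ 2)) has_sum A) UNIV"
  proof -
    have "(\<lambda>l. (q ^ 5) ^ nat (l ^ 2)) summable_on UNIV"
      unfolding q
    proof (rule X5_power_summable)
      show "\<bar>l\<bar> \<le> int (nat (l\<^sup>2)) + 1" for l :: int
        using abs_le_power2[of l] by simp
    qed
    then show ?thesis using that unfolding summable_on_def by blast
  qed
  obtain B where B: "((\<lambda>l. (q ^ 5) ^ nat (l * (l + 1))) has_sum B) UNIV"
  proof -
    have "(\<lambda>l. (q ^ 5) ^ nat (l * (l + 1))) summable_on UNIV"
      unfolding q
    proof (rule X5_power_summable)
      show "\<bar>l\<bar> \<le> int (nat (l * (l + 1))) + 1" for l :: int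
      proof -
        have "l * (l + 1) = l ^ 2 + l" "l * (l + 1) = (l + 1) ^ 2 - (l + 1)"
          by (simp_all add: power2_eq_square algebra_simps)
        moreover have "0 \<le> l * (l + 1)" using two_tri[of l] by linarith
        ultimately show ?thesis using abs_le_power2[of l] abs_le_power2[of "l + 1"] by (cases "l \<ge> 0") auto
      qed
    qed
    then show ?thesis using that unfolding summable_on_def by blast
  qed
  have AB: "series_in_X5 A" "series_in_X5 B"
    by (rule series_in_X5_has_sum[OF A] series_in_X5_has_sum[OF B], simp add: q series_in_X5_power flip: power_mult)+

  \<comment> \<open>The choice of \<open>z\<close> makes \<open>x ^ 2 * z\<close> equal to
    \<open>q ^ 5\<close>.\<close>
  have sq: "(m1 * E5) ^ 2 = A * (K1 * E10) + q ^ r * (B * (K2 * E10))"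
  proof (rule theta_square[where z = "q ^ (5 - 2 * r)"])
    have "r + (5 - 2 * r) = 5 - r" "2 * r + 2 * (5 - 2 * r) = 10 - 2 * r"
      "4 * r + (5 - 2 * r) = 5 + 2 * r" "2 * r + (5 - 2 * r) = 5" using r' by auto
    then have e: "q ^ r * q ^ (5 - 2 * r) = q ^ (5 - r)" "(q ^ r) ^ 2 = q ^ (2 * r)"
      "(q ^ r) ^ 2 * (q ^ (5 - 2 * r)) ^ 2 = q ^ (10 - 2 * r)"
      "(q ^ r) ^ 4 * q ^ (5 - 2 * r) = q ^ (5 + 2 * r)" "(q ^ r) ^ 2 * q ^ (5 - 2 * r) = q ^ 5"
      by (simp_all add: mult.commute[of r] mult.commute[of "5 - 2 * r"] add.commute[of 5 "2 * r"] flip: power_add power_mult)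
    show "(theta_term (q ^ r) (q ^ r * q ^ (5 - 2 * r)) has_sum m1 * E5) UNIV" unfolding e(1) by (rule F0)
    show "(theta_term ((q ^ r) ^ 2) ((q ^ r) ^ 2 * (q ^ (5 - 2 * r)) ^ 2) has_sum K1 * E10) UNIV"
      unfolding e(3) unfolding e(2) by (rule F1)
    show "(theta_term (q ^ (5 - 2 * r)) ((q ^ r) ^ 4 * q ^ (5 - 2 * r)) has_sum K2 * E10) UNIV" unfolding e(4) by (rule F2)
    show "((\<lambda>l. ((q ^ r) ^ 2 * q ^ (5 - 2 * r)) ^ nat (l ^ 2)) has_sum A) UNIV" unfolding e(5) by (rule A)
    show "((\<lambda>l. ((q ^ r) ^ 2 * q ^ (5 - 2 * r)) ^ nat (l * (l + 1))) has_sum B) UNIV" unfolding e(5) by (rule B)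
  qed

  \<comment> \<open>The parameters \<open>(c, 0)\<close> and \<open>(3 - c, 1)\<close> give
    \<open>\<sigma> = 2 * c\<close> and \<open>\<sigma> = 5 - 2 * c\<close>, matching
    \<open>K1\<close> and \<open>K2\<close>, while \<open>\<rho>\<close> is \<open>2 * c\<close> and
    \<open>10 - 2 * c\<close>, so both quotients have the numerator \<open>N\<close>.\<close>
  define c :: int where "c = int r"
  have c: "c \<in> {1, 2}" "3 - c \<in> {1, 2}" using r by (auto simp: c_def)
  have k01: "(0::int) \<in> {0, 1}" "(1::int) \<in> {0, 1}" by auto
  have xp: "xpow (2 * c) = q ^ (2 * r)" "xpow (10 - 2 * c) = q ^ (10 - 2 * r)"
    "xpow (5 - 2 * c) = q ^ (5 - 2 * r)" "xpow (5 + 2 * c) = q ^ (5 + 2 * r)"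
    using r by (auto simp: xpow_def q c_def)
  have lambert_summable: "\<exists>L. (lambert_term c' \<kappa> has_sum L) UNIV" if "c' \<in> {1, 2}" "\<kappa> \<in> {0, 1}" for c' \<kappa>
    using lambert_term_mult_summable[OF that, of "\<lambda>_. 1"] by (simp add: summable_on_def)
  have D_ex: "\<exists>D. ((\<lambda>l. lambert_term c' \<kappa> l * g l) has_sum D) UNIV" if "c' \<in> {1, 2}" "\<kappa> \<in> {0, 1}" for c' \<kappa> g
    using lambert_term_mult_summable[OF that, of g] by (simp add: summable_on_def)
  obtain L1 where L1: "(lambert_term c 0 has_sum L1) UNIV" using lambert_summable c k01 by blast
  obtain L2 where L2: "(lambert_term (3 - c) 1 has_sum L2) UNIV" using lambert_summable c k01 by blast
  obtain D1 where D1: "((\<lambda>l. lambert_term c 0 l * theta_term (xpow (2 * c - 0)) (xpow (10 - (2 * c - 0))) (- l)) has_sum D1) UNIV"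
    using D_ex[OF c(1) k01(1), of "\<lambda>l. theta_term (xpow (2 * c - 0)) (xpow (10 - (2 * c - 0))) (- l)"] by blast
  obtain D2 where D2: "((\<lambda>l. lambert_term (3 - c) 1 l * theta_term (xpow (2 * (3 - c) - 1)) (xpow (10 - (2 * (3 - c) - 1))) (- l)) has_sum D2) UNIV"
    using D_ex[OF c(2) k01(2), of "\<lambda>l. theta_term (xpow (2 * (3 - c) - 1)) (xpow (10 - (2 * (3 - c) - 1))) (- l)"] by blast
  have Q1: "L1 * (K1 * E10) = D1 * (N * E10)"
    by (rule lambert_theta_quotient[OF c(1) k01(1) L1 _ _ D1]) (use F1 N1 in \<open>simp_all add: xp\<close>)
  have xi: "2 * (3 - c) - 1 = 5 - 2 * c" "10 - (5 - 2 * c) = 5 + 2 * c" "2 * (3 - c) + 4 * 1 = 10 - 2 * c" "10 - (10 - 2 * c) = 2 * c"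
    by simp_all
  have Q2: "L2 * (K2 * E10) = D2 * (N * E10)"
    by (rule lambert_theta_quotient[OF c(2) k01(2) L2 _ _ D2]; unfold xi xp; rule F2 N2)
  note D1' = lambert_constant[OF c(1) k01(1) D1]
  note D2' = lambert_constant[OF c(2) k01(2) D2]

  \<comment> \<open>\<open>L1\<close> vanishes in the class of \<open>- 2 * r ^ 2\<close>, and
    multiplication by \<open>q ^ r\<close> moves it to class 4 for both values of
    \<open>r\<close>.\<close>
  have v1: "vanish_4_mod_5 (L1 * q ^ r)"
    unfolding vanish_4_mod_5_def
  proof
    fix n
    have "fps_nth L1 (5 * n + 4 - r) = 0"
    proof (rule lambert_series_vanish[OF c(1) k01(1) L1])
      show "5 * n + 4 - r > 0" using r' by linarith
      show "int (5 * n + 4 - r) mod 5 = (- c * (2 * c - 0)) mod 5"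
        using r unfolding c_def by (elim disjE; simp; presburger)
    qed
    then show "fps_nth (L1 * q ^ r) (5 * n + 4) = 0" using r' by (simp add: q fps_X_power_mult_right_nth)
  qed
  have v2: "vanish_4_mod_5 L2"
    unfolding vanish_4_mod_5_def
  proof
    fix n
    show "fps_nth L2 (5 * n + 4) = 0"
    proof (rule lambert_series_vanish[OF c(2) k01(2) L2])
      show "int (5 * n + 4) mod 5 = (- (3 - c) * (2 * (3 - c) - 1)) mod 5"
        using r unfolding c_def by (elim disjE; simp; presburger)
    qed simp
  qed

  have Sm: "S * m2 = m1 ^ 3 * n1" using S unfolding m1_def n1_def m2_def .
  \<comment> \<open>With \<open>D1\<close> and \<open>D2\<close> multiplied in, \<open>Q1\<close>
    and \<open>Q2\<close> replace \<open>N\<close> by Lambert series, and \<open>K1 * K2\<close>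
    then splits off both summands.\<close>
  have "(K1 * K2) * (S * (E5 ^ 2 * (D1 * D2))) = (m1 * E5) ^ 2 * (m1 * n1) * (D1 * D2)"
    using Sm unfolding m2 by algebra
  also have "\<dots> = A * K1 * D1 * (D2 * (N * E10)) + B * K2 * D2 * (D1 * (N * E10)) * q ^ r"
    unfolding sq m1n1 by (simp add: algebra_simps)
  also have "\<dots> = (K1 * K2) * (E10 * (A * D1 * L2 + B * D2 * (L1 * q ^ r)))"
    unfolding Q1[symmetric] Q2[symmetric] by (simp add: algebra_simps)
  finally have "S * (E5 ^ 2 * (D1 * D2)) = E10 * (A * D1 * L2 + B * D2 * (L1 * q ^ r))"
    using K0 by (subst (asm) mult_cancel_left) auto
  moreover have "vanish_4_mod_5 (L2 * (E10 * (A * D1)))" "vanish_4_mod_5 (L1 * q ^ r * (E10 * (B * D2)))"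
    using v1 v2 E10 AB D1' D2' by (auto intro!: vanish_4_mod_5_mult series_in_X5_mult)
  ultimately have "vanish_4_mod_5 (S * (E5 ^ 2 * (D1 * D2)))"
    by (simp add: vanish_4_mod_5_def algebra_simps)
  moreover have "series_in_X5 (E5 ^ 2 * (D1 * D2))"
    using E5 D1' D2' by (simp add: power2_eq_square series_in_X5_mult)
  moreover have "fps_nth (E5 ^ 2 * (D1 * D2)) 0 \<noteq> 0"
    using E5 D1' D2' by (simp add: power2_eq_square fps_mult_nth)
  ultimately show ?thesis by (rule vanish_4_mod_5_cancel)
qed

section \<open>Reduction of the two given quotients to the cubic theta form\<close>

lemma fps_eq_divideD:
  fixes F G H :: "complex fps"
  assumes "F = G / H" "fps_nth H 0 \<noteq> 0"
  shows "F * H = G"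
  using assms by (simp add: fps_divide_unit mult.assoc inverse_mult_eq_1)

theorem theorem1p2:
  fixes q :: "complex fps" and \<gamma> \<delta> :: "nat \<Rightarrow> complex"
  assumes "q = fps_X"
    and "Abs_fps \<gamma> =
      (qpochs_inf [- q, - (q ^ 4)] (q ^ 5) ^ 2 * qpochs_inf [q ^ 4, q ^ 6] (q ^ 10)) /
      (qpochs_inf [- (q ^ 2), - (q ^ 3)] (q ^ 5) ^ 2 * qpochs_inf [q ^ 3, q ^ 7] (q ^ 10))"
    and "Abs_fps \<delta> =
      (qpochs_inf [- (q ^ 2), - (q ^ 3)] (q ^ 5) ^ 2 * qpochs_inf [q ^ 2, q ^ 8] (q ^ 10)) /
      (qpochs_inf [- q, - (q ^ 4)] (q ^ 5) ^ 2 * qpochs_inf [q, q ^ 9] (q ^ 10))"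
  shows "\<forall>n. \<gamma> (5 * n + 4) = 0 \<and> \<delta> (5 * n + 4) = 0"
proof -
  define p where "p = (\<lambda>j. qpoch_inf (- (q ^ j)) (q ^ 5))"
  define u where "u = (\<lambda>j. qpoch_inf (q ^ j) (q ^ 5))"
  define w where "w = (\<lambda>j. qpoch_inf (q ^ j) (q ^ 10))"
  have qn: "q \<noteq> 0" "fps_nth (q ^ k) 0 = (if k = 0 then 1 else 0)" for k by (simp_all add: assms(1))
  have p0: "fps_nth (p j) 0 = 1" and u0: "fps_nth (u j) 0 = 1" and w0: "fps_nth (w j) 0 = 1" if "j > 0" for j
    unfolding p_def u_def w_def using that by (simp_all add: qpoch_inf_nth_0 qn)
  have up: "u j * p j = w (2 * j)" if "j > 0" for j
    unfolding p_def u_def w_def using qpoch_inf_mult_neg[of "q ^ j" "q ^ 5"] that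
    by (simp add: qn mult.commute flip: power_mult)
  have us: "u j = w j * w (j + 5)" if "j > 0" for j
    unfolding u_def w_def using qpoch_inf_split[of "q ^ j" "q ^ 5"] that by (simp add: qn flip: power_mult power_add)
  have P: "qpochs_inf [- q, - (q ^ 4)] (q ^ 5) = p 1 * p 4" "qpochs_inf [- (q ^ 2), - (q ^ 3)] (q ^ 5) = p 2 * p 3"
    "qpochs_inf [q ^ 4, q ^ 6] (q ^ 10) = w 4 * w 6" "qpochs_inf [q ^ 3, q ^ 7] (q ^ 10) = w 3 * w 7"
    "qpochs_inf [q ^ 2, q ^ 8] (q ^ 10) = w 2 * w 8" "qpochs_inf [q, q ^ 9] (q ^ 10) = w 1 * w 9"
    by (simp_all add: qpochs_inf_def p_def w_def)
  have mult0: "fps_nth (a * b) 0 = fps_nth a 0 * fps_nth b 0" for a b :: "complex fps" by simp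
  have up': "u 1 * p 1 = w 2" "u 2 * p 2 = w 4" "u 3 * p 3 = w 6" "u 4 * p 4 = w 8"
    using up[of 1] up[of 2] up[of 3] up[of 4] by simp_all
  have us': "u 1 = w 1 * w 6" "u 2 = w 2 * w 7" "u 3 = w 3 * w 8" "u 4 = w 4 * w 9"
    using us[of 1] us[of 2] us[of 3] us[of 4] by simp_all
  have nz: "p j \<noteq> 0" "u j \<noteq> 0" if "j > 0" for j using p0[OF that] u0[OF that] by auto
  have "Abs_fps \<gamma> * ((p 2 * p 3) ^ 2 * (w 3 * w 7)) = (p 1 * p 4) ^ 2 * (w 4 * w 6)"
    using assms(2) unfolding P by (rule fps_eq_divideD) (simp add: mult0 power2_eq_square p0 w0)
  \<comment> \<open>The relations \<open>up'\<close> and \<open>us'\<close> eliminate all products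
    to base \<open>q ^ 10\<close>; the extra nonzero factor makes this possible without
    division.\<close>
  then have "(p 2 * p 3 * u 2 * u 3) * (Abs_fps \<gamma> * (p 2 * p 3)) = (p 2 * p 3 * u 2 * u 3) * ((p 1 * p 4) ^ 3 * (u 1 * u 4))"
    using up' us' by algebra
  then have "Abs_fps \<gamma> * (p 2 * p 3) = (p 1 * p 4) ^ 3 * (u 1 * u 4)"
    using nz by (subst (asm) mult_cancel_left) simp
  then have g: "vanish_4_mod_5 (Abs_fps \<gamma>)"
    unfolding p_def u_def using assms(1) by (intro theta_cube_quotient_vanish[of 1 q]) simp_all
  have "Abs_fps \<delta> * ((p 1 * p 4) ^ 2 * (w 1 * w 9)) = (p 2 * p 3) ^ 2 * (w 2 * w 8)"
    using assms(3) unfolding P by (rule fps_eq_divideD) (simp add: mult0 power2_eq_square p0 w0)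
  \<comment> \<open>For \<open>r = 2\<close> the denominator exponents are \<open>2 * r = 4\<close>
    and \<open>5 - 2 * r = 1\<close>, hence the order \<open>p 4 * p 1\<close>.\<close>
  then have "(p 1 * p 4 * u 1 * u 4) * (Abs_fps \<delta> * (p 4 * p 1)) = (p 1 * p 4 * u 1 * u 4) * ((p 2 * p 3) ^ 3 * (u 2 * u 3))"
    using up' us' by algebra
  then have "Abs_fps \<delta> * (p 4 * p 1) = (p 2 * p 3) ^ 3 * (u 2 * u 3)"
    using nz by (subst (asm) mult_cancel_left) simp
  then have d: "vanish_4_mod_5 (Abs_fps \<delta>)"
    unfolding p_def u_def using assms(1) by (intro theta_cube_quotient_vanish[of 2 q]) simp_all
  show ?thesis using g d by (simp add: vanish_4_mod_5_def)
qed

end
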